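(* Let $G$ be a Cohen--Macaulay Cameron--Walker graph, consisting of a connected bipartite graph with vertex partition $\{x_1,\ldots,x_n\}\cup\{y_1,\ldots,y_m\}$, exactly one leaf edge $\{x_i,w_i\}$ attached to each $x_i$, and exactly one pendant triangle on $\{y_j,z_j,w_{n+j}\}$ attached to each $y_j$. Put $V'=\{x_1,\ldots,x_n\}\cup\{y_1,\ldots,y_m\}\cup\{z_1,\ldots,z_m\}$. Then (1) for all $i$, $$\beta_i(J(G))=\sum_{C\in\mathrm{Min}(G)}\binom{|V'\setminus C|}{i};$$ (2) $\mathrm{pd}(J(G))=\max\{|V'\setminus C| : C\in\mathrm{Min}(G)\}$. In particular, the graded Betti numbers of $J(G)$ do not depend on the characteristic of the field $\Bbbk$.
   Context: Graphs are finite simple graphs; $\Bbbk$ is an arbitrary field. $\mathrm{m}(G)$ is the maximal size of a matching and $\mathrm{im}(G)$ the maximal size of an induced matching of $G$. A Cameron--Walker graph is a finite connected simple graph $G$ with $\mathrm{im}(G)=\mathrm{m}(G)$ which is neither a star graph nor a star triangle. $G$ is Cohen--Macaulay if $\Bbbk[V(G)]/I(G)$ is Cohen--Macaulay, where $I(G)$ is the edge ideal (generated by $uv$, $\{u,v\}\in E(G)$). By a known theorem (Hibi--Higashitani--Kimura--O'Keefe) a Cameron--Walker graph is Cohen--Macaulay if and only if it has the structure described in the claim. $\mathrm{Min}(G)$ is the set of inclusion-minimal vertex covers of $G$. The cover ideal $J(G)\subseteq\Bbbk[V(G)]$ is generated by the monomials $\prod_{v\in C}v$, $C$ a vertex cover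 of $G$. $\beta_i$ is the $i$-th (total) Betti number over $\Bbbk[V(G)]$, $\mathrm{pd}$ is projective dimension. *)

theory Defs
  imports
    Complex_Main
    "HOL-Library.Poly_Mapping"
    "HOL-Library.Extended_Nat"
    "Jordan_Normal_Form.Matrix"
begin

section \<open>Graphs\<close>

text \<open>
  A graph is given by its set of edges \<open>E\<close>; its vertex set is the whole (finite) type \<open>'v\<close>.
\<close>

definition simple_graph :: "'v::finite set set \<Rightarrow> bool" where
  "simple_graph E \<longleftrightarrow> (\<forall>e\<in>E. card e = 2)"

definition connected_on :: "'v set \<Rightarrow> 'v set set \<Rightarrow> bool" where
  "connected_on W E \<longleftrightarrow> (\<forall>a\<in>W. \<forall>b\<in>W. (a, b) \<in> {(u, v). u \<in> W \<and> v \<in> W \<and> {u, v} \<in> E}\<^sup>*)"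

definition matching :: "'v set set \<Rightarrow> 'v set set \<Rightarrow> bool" where
  "matching E M \<longleftrightarrow> M \<subseteq> E \<and> (\<forall>e\<in>M. \<forall>f\<in>M. e \<noteq> f \<longrightarrow> e \<inter> f = {})"

definition induced_matching :: "'v set set \<Rightarrow> 'v set set \<Rightarrow> bool" where
  "induced_matching E M \<longleftrightarrow> matching E M \<and>
     (\<forall>e\<in>M. \<forall>f\<in>M. e \<noteq> f \<longrightarrow> \<not> (\<exists>g\<in>E. g \<inter> e \<noteq> {} \<and> g \<inter> f \<noteq> {}))"

definition matching_number :: "'v::finite set set \<Rightarrow> nat" where
  "matching_number E = Max (card ` {M. matching E M})"

definition induced_matching_number :: "'v::finite set set \<Rightarrow> nat" where
  "induced_matching_number E = Max (card ` {M. induced_matching E M})"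

definition star_graph :: "'v::finite set set \<Rightarrow> bool" where
  "star_graph E \<longleftrightarrow> (\<exists>c. E = {{c, v} | v. v \<noteq> c})"

text \<open>
  A star triangle consists of triangles sharing one common vertex \<open>c\<close>; \<open>T\<close> is the set of the
  edges opposite to \<open>c\<close>.
\<close>

definition star_triangle :: "'v::finite set set \<Rightarrow> bool" where
  "star_triangle E \<longleftrightarrow>
     (\<exists>c T. (\<forall>e\<in>T. card e = 2) \<and> (\<forall>e\<in>T. \<forall>f\<in>T. e \<noteq> f \<longrightarrow> e \<inter> f = {}) \<and> \<Union>T = UNIV - {c} \<and>
            E = T \<union> {{c, v} | v. v \<noteq> c})"

definition cameron_walker :: "'v::finite set set \<Rightarrow> bool" where
  "cameron_walker E \<longleftrightarrow> simple_graph E \<and> connected_on UNIV E \<and>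
     induced_matching_number E = matching_number E \<and> \<not> star_graph E \<and> \<not> star_triangle E"

definition vertex_cover :: "'v set set \<Rightarrow> 'v set \<Rightarrow> bool" where
  "vertex_cover E C \<longleftrightarrow> (\<forall>e\<in>E. e \<inter> C \<noteq> {})"

definition min_vertex_covers :: "'v set set \<Rightarrow> 'v set set" where
  "min_vertex_covers E = {C. vertex_cover E C \<and> (\<forall>D. D \<subset> C \<longrightarrow> \<not> vertex_cover E D)}"

definition leaf_triangle_structure ::
  "'v::finite set set \<Rightarrow> nat \<Rightarrow> nat \<Rightarrow> (nat \<Rightarrow> 'v) \<Rightarrow> (nat \<Rightarrow> 'v) \<Rightarrow> (nat \<Rightarrow> 'v) \<Rightarrow> (nat \<Rightarrow> 'v) \<Rightarrow> bool"
  where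
  "leaf_triangle_structure E n m x y z w \<longleftrightarrow>
     inj_on x {1..n} \<and> inj_on y {1..m} \<and> inj_on z {1..m} \<and> inj_on w {1..n + m} \<and>
     x ` {1..n} \<inter> y ` {1..m} = {} \<and> x ` {1..n} \<inter> z ` {1..m} = {} \<and>
     x ` {1..n} \<inter> w ` {1..n + m} = {} \<and> y ` {1..m} \<inter> z ` {1..m} = {} \<and>
     y ` {1..m} \<inter> w ` {1..n + m} = {} \<and> z ` {1..m} \<inter> w ` {1..n + m} = {} \<and>
     x ` {1..n} \<union> y ` {1..m} \<union> z ` {1..m} \<union> w ` {1..n + m} = UNIV \<and>
     (\<exists>B. B \<subseteq> {{x i, y j} | i j. i \<in> {1..n} \<and> j \<in> {1..m}} \<and>
          connected_on (x ` {1..n} \<union> y ` {1..m}) B \<and>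
          E = B \<union> {{x i, w i} | i. i \<in> {1..n}}
                \<union> (\<Union>j\<in>{1..m}. {{y j, z j}, {y j, w (n + j)}, {z j, w (n + j)}}))"


section \<open>The polynomial ring and its ideals\<close>

text \<open>
  Exponent vectors are finitely supported functions \<open>'v \<Rightarrow>\<^sub>0 nat\<close>, so \<open>('v, 'k) mpol\<close> with the
  convolution product is the polynomial ring with one variable for each element of \<open>'v\<close>.
\<close>

type_synonym ('v, 'k) mpol = "('v \<Rightarrow>\<^sub>0 nat) \<Rightarrow>\<^sub>0 'k"

definition var :: "'v \<Rightarrow> ('v, 'k::comm_ring_1) mpol" where
  "var v = Poly_Mapping.single (Poly_Mapping.single v 1) 1"

definition homogeneous_of_degree :: "nat \<Rightarrow> ('v, 'k::zero) mpol \<Rightarrow> bool" where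
  "homogeneous_of_degree d p \<longleftrightarrow>
     (\<forall>t\<in>Poly_Mapping.keys p. (\<Sum>v\<in>Poly_Mapping.keys t. Poly_Mapping.lookup t v) = d)"

text \<open>Ideals are the submodules of the ring, regarded as a module over itself.\<close>

lemma module_ring: "Modules.module ((*) :: 'r::comm_ring_1 \<Rightarrow> 'r \<Rightarrow> 'r)"
  by unfold_locales (simp_all add: algebra_simps)

abbreviation is_ideal :: "'r::comm_ring_1 set \<Rightarrow> bool" where
  "is_ideal \<equiv> Modules.module.subspace (*)"

abbreviation ideal_gen :: "'r::comm_ring_1 set \<Rightarrow> 'r set" where
  "ideal_gen \<equiv> Modules.module.span (*)"

definition irrelevant_ideal :: "('v, 'k::comm_ring_1) mpol set" where
  "irrelevant_ideal = ideal_gen (range var)"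

definition edge_ideal :: "'v::finite set set \<Rightarrow> ('v, 'k::field) mpol set" where
  "edge_ideal E = ideal_gen ((\<lambda>e. \<Prod>v\<in>e. var v) ` E)"

definition cover_ideal :: "'v::finite set set \<Rightarrow> ('v, 'k::field) mpol set" where
  "cover_ideal E = ideal_gen ((\<lambda>C. \<Prod>v\<in>C. var v) ` {C. vertex_cover E C})"


section \<open>Cohen--Macaulay quotients\<close>

definition is_prime_ideal :: "'r::comm_ring_1 set \<Rightarrow> bool" where
  "is_prime_ideal P \<longleftrightarrow> is_ideal P \<and> P \<noteq> UNIV \<and> (\<forall>a b. a * b \<in> P \<longrightarrow> a \<in> P \<or> b \<in> P)"

text \<open>
  Krull dimension of the quotient by \<open>I\<close>: its prime ideals correspond to the prime ideals
  containing \<open>I\<close>.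
\<close>

definition krull_dim_quot :: "'r::comm_ring_1 set \<Rightarrow> enat" where
  "krull_dim_quot I = Sup {enat n | n. \<exists>P :: nat \<Rightarrow> 'r set.
     (\<forall>i\<le>n. is_prime_ideal (P i) \<and> I \<subseteq> P i) \<and> (\<forall>i<n. P i \<subset> P (Suc i))}"

text \<open>
  \<open>fs\<close> is a regular sequence on the quotient by \<open>I\<close>; everything is pulled back to the ring.
\<close>

definition regular_sequence_quot :: "'r::comm_ring_1 set \<Rightarrow> 'r list \<Rightarrow> bool" where
  "regular_sequence_quot I fs \<longleftrightarrow>
     (\<forall>i<length fs. \<forall>p. fs ! i * p \<in> ideal_gen (I \<union> set (take i fs)) \<longrightarrow>
        p \<in> ideal_gen (I \<union> set (take i fs))) \<and>
     ideal_gen (I \<union> set fs) \<noteq> UNIV"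

definition depth_quot :: "('v, 'k::field) mpol set \<Rightarrow> enat" where
  "depth_quot I =
     Sup {enat (length fs) | fs. set fs \<subseteq> irrelevant_ideal \<and> regular_sequence_quot I fs}"

text \<open>
  For a homogeneous ideal \<open>I\<close>, Cohen--Macaulayness of the graded quotient is tested at the
  irrelevant maximal ideal.
\<close>

definition cohen_macaulay_quot :: "('v, 'k::field) mpol set \<Rightarrow> bool" where
  "cohen_macaulay_quot I \<longleftrightarrow> depth_quot I = krull_dim_quot I"

definition cohen_macaulay_graph :: "'k::field itself \<Rightarrow> 'v::finite set set \<Rightarrow> bool" where
  "cohen_macaulay_graph _ E \<longleftrightarrow> cohen_macaulay_quot (edge_ideal E :: ('v, 'k) mpol set)"


section \<open>Resolutions, Betti numbers and projective dimension\<close>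

definition vec_submodule :: "nat \<Rightarrow> 'r::comm_ring_1 vec set \<Rightarrow> bool" where
  "vec_submodule r P \<longleftrightarrow> P \<subseteq> carrier_vec r \<and> 0\<^sub>v r \<in> P \<and>
     (\<forall>u\<in>P. \<forall>v\<in>P. u + v \<in> P) \<and> (\<forall>a. \<forall>v\<in>P. a \<cdot>\<^sub>v v \<in> P)"

definition direct_summand :: "nat \<Rightarrow> 'r::comm_ring_1 vec set \<Rightarrow> bool" where
  "direct_summand r P \<longleftrightarrow> vec_submodule r P \<and>
     (\<exists>Q. vec_submodule r Q \<and> P \<inter> Q = {0\<^sub>v r} \<and> {u + v | u v. u \<in> P \<and> v \<in> Q} = carrier_vec r)"

text \<open>
  A resolution \<open>\<dots> \<rightarrow> P 2 \<rightarrow> P 1 \<rightarrow> P 0 \<rightarrow> J \<rightarrow> 0\<close> of an ideal \<open>J\<close> by finitely generated projective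
  modules. Each \<open>P i\<close> is a direct summand of the free module of rank \<open>r i\<close>. Every linear map
  \<open>P (Suc i) \<rightarrow> P i\<close> extends to the ambient free modules, hence is the restriction of a
  matrix \<open>D i\<close>; likewise the augmentation \<open>P 0 \<rightarrow> J\<close> is the scalar product with a vector \<open>eps\<close>.
\<close>

definition projective_resolution ::
  "'r::comm_ring_1 set \<Rightarrow> (nat \<Rightarrow> nat) \<Rightarrow> (nat \<Rightarrow> 'r vec set) \<Rightarrow> 'r vec \<Rightarrow> (nat \<Rightarrow> 'r mat) \<Rightarrow> bool"
  where
  "projective_resolution J r P eps D \<longleftrightarrow>
     (\<forall>i. direct_summand (r i) (P i)) \<and>
     eps \<in> carrier_vec (r 0) \<and>
     (\<forall>i. D i \<in> carrier_mat (r i) (r (Suc i))) \<and>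
     (\<lambda>v. eps \<bullet> v) ` P 0 = J \<and>
     {v \<in> P 0. eps \<bullet> v = 0} = (\<lambda>v. D 0 *\<^sub>v v) ` P 1 \<and>
     (\<forall>i. {v \<in> P (Suc i). D i *\<^sub>v v = 0\<^sub>v (r i)} = (\<lambda>v. D (Suc i) *\<^sub>v v) ` P (Suc (Suc i)))"

definition projective_dimension :: "'r::comm_ring_1 set \<Rightarrow> enat" where
  "projective_dimension J = Inf {enat n | n. \<exists>r P eps D.
     projective_resolution J r P eps D \<and> (\<forall>i>n. P i = {0\<^sub>v (r i)})}"

text \<open>
  The \<open>i\<close>-th module is free of rank \<open>r i\<close>, its \<open>a\<close>-th basis vector (\<open>a < r i\<close>) having degree
  \<open>d i a\<close>. All maps preserve degrees, and minimality means that the entries of the differentials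
  lie in the irrelevant ideal.
\<close>

definition minimal_graded_free_resolution ::
  "('v, 'k::field) mpol set \<Rightarrow> (nat \<Rightarrow> nat) \<Rightarrow> (nat \<Rightarrow> nat \<Rightarrow> nat) \<Rightarrow>
   ('v, 'k) mpol vec \<Rightarrow> (nat \<Rightarrow> ('v, 'k) mpol mat) \<Rightarrow> bool"
  where
  "minimal_graded_free_resolution J r d eps D \<longleftrightarrow>
     projective_resolution J r (\<lambda>i. carrier_vec (r i)) eps D \<and>
     (\<forall>a<r 0. homogeneous_of_degree (d 0 a) (eps $ a)) \<and>
     (\<forall>i. \<forall>a<r i. \<forall>b<r (Suc i).
        (if d i a \<le> d (Suc i) b then homogeneous_of_degree (d (Suc i) b - d i a) (D i $$ (a, b))
         else D i $$ (a, b) = 0) \<and>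
        D i $$ (a, b) \<in> irrelevant_ideal)"

text \<open>
  A minimal graded free resolution of a homogeneous ideal is unique up to isomorphism, so the
  definite descriptions below are meaningful.
\<close>

definition graded_betti :: "nat \<Rightarrow> nat \<Rightarrow> ('v, 'k::field) mpol set \<Rightarrow> nat" where
  "graded_betti i j J = (THE b. \<exists>r d eps D.
     minimal_graded_free_resolution J r d eps D \<and> b = card {a. a < r i \<and> d i a = j})"

definition betti :: "nat \<Rightarrow> ('v, 'k::field) mpol set \<Rightarrow> nat" where
  "betti i J = (THE b. \<exists>r d eps D. minimal_graded_free_resolution J r d eps D \<and> b = r i)"

end

theory Submission
  imports Defs "HOL-Library.Countable" "Jordan_Normal_Form.Determinant"
begin

text \<open>
  A minimal vertex cover \<open>C\<close> contains one end of every leaf edge and two vertices of every triangle.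
  Hence each \<open>s \<in> V' - C\<close> can be swapped in for the vertex \<open>om s\<close> outside \<open>V'\<close> of its leaf edge or
  triangle, and ordering the covers by the size of \<open>V' - C\<close> gives linear quotients: the colon ideal
  belonging to \<open>C\<close> is generated by the variables in \<open>V' - C\<close>. The resulting resolution is written down
  explicitly as the complex of the cubes \<open>(T, C)\<close> with \<open>T \<subseteq> V' - C\<close>. It is exact because its
  top-level part with respect to the size of \<open>V' - C\<close> is a Koszul complex on variables, and it is
  minimal and linear, so its ranks are the Betti numbers.

  An arbitrary projective resolution is compared with a minimal free one by chain maps in both
  directions. Their composite is homotopic to the identity of the minimal resolution, hence equal to
  it modulo the variables. This yields the uniqueness of the graded Betti numbers and shows that no
  projective resolution is shorter than the minimal one.
\<close>

section \<open>Polynomials\<close>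

text \<open>A swap of \<open>om s\<close> for \<open>s\<close> shrinks \<open>V' - C\<close> by
  exactly one element. The part of the boundary that changes the cover therefore lowers the level,
  and this is what leaves a Koszul complex on each level. Only swaps into \<open>V'\<close> are
  available: the reverse exchange can uncover an edge of the bipartite part, so terms that run a
  swap backwards must be killed by the support of the chain. The vertices \<open>y j\<close> and
  \<open>z j\<close> share the same \<open>om\<close>, which would spoil the commutation of two
  swaps; but a cover contains at least one of them, so they never occur together in a cell. Chains
  of all dimensions are functions on the set of all cells, and matrices appear only when the complex
  is fitted to the definition of a resolution. Linearity holds because all minimal covers have as
  many vertices as \<open>V'\<close>. Uniqueness must be proved because Betti numbers are definite
  descriptions, and the comparison must admit projective modules because the projective dimension is
  an infimum over projective resolutions.\<close>

interpretation ring: Modules.module "(*) :: 'r::comm_ring_1 \<Rightarrow> 'r \<Rightarrow> 'r"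
  by (rule module_ring)

(* As a simp rule it undoes mult.assoc, so that both together do not terminate. *)
declare ring.scale_scale [simp del]

definition mdeg :: "('v \<Rightarrow>\<^sub>0 nat) \<Rightarrow> nat" where
  "mdeg t = (\<Sum>v\<in>Poly_Mapping.keys t. Poly_Mapping.lookup t v)"

lemma mdeg_UNIV: "mdeg t = (\<Sum>v\<in>UNIV. Poly_Mapping.lookup t (v::'v::finite))"
  unfolding mdeg_def by (rule sum.mono_neutral_left) (auto simp: in_keys_iff)

lemma mdeg_add: "mdeg (s + t) = mdeg s + mdeg (t :: 'v::finite \<Rightarrow>\<^sub>0 nat)"
  by (simp add: mdeg_UNIV lookup_add sum.distrib)

text \<open>
  The degree is taken in the integers so that a map of graded free modules has an entry
  homogeneous of the difference of the degrees also when that difference is negative; the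
  entry is then zero.
\<close>

definition ihom :: "int \<Rightarrow> ('v, 'k::zero) mpol \<Rightarrow> bool" where
  "ihom d p \<longleftrightarrow> (\<forall>t\<in>Poly_Mapping.keys p. int (mdeg t) = d)"

lemma ihom_of_nat: "ihom (int d) p \<longleftrightarrow> homogeneous_of_degree d p"
  by (simp add: ihom_def homogeneous_of_degree_def flip: mdeg_def)

lemma ihom_zero [simp]: "ihom d 0"
  by (simp add: ihom_def)

lemma ihom_add: "ihom d p \<Longrightarrow> ihom d q \<Longrightarrow> ihom d (p + q)"
  using keys_add[of p q] by (auto simp: ihom_def)

lemma ihom_sum: "(\<And>i. i \<in> I \<Longrightarrow> ihom d (f i)) \<Longrightarrow> ihom d (sum f I)"
  by (induction I rule: infinite_finite_induct) (auto intro: ihom_add)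

lemma ihom_uminus: "ihom d p \<Longrightarrow> ihom d (- p :: ('v, 'k::ab_group_add) mpol)"
  by (auto simp: ihom_def in_keys_iff)

lemma ihom_diff: "ihom d p \<Longrightarrow> ihom d q \<Longrightarrow> ihom d (p - q :: ('v, 'k::ab_group_add) mpol)"
  using ihom_add[of d p "- q"] ihom_uminus[of d q] by simp

lemma ihom_mult:
  fixes p q :: "('v::finite, 'k::comm_ring_1) mpol"
  assumes "ihom d p" "ihom e q"
  shows "ihom (d + e) (p * q)"
  unfolding ihom_def
proof
  fix t assume "t \<in> Poly_Mapping.keys (p * q)"
  then obtain a b where "a \<in> Poly_Mapping.keys p" "b \<in> Poly_Mapping.keys q" "t = a + b"
    using keys_mult[of p q] by auto
  then show "int (mdeg t) = d + e" using assms by (simp add: ihom_def mdeg_add)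
qed

lemma ihom_var: "ihom 1 (var v :: ('v, 'k::comm_ring_1) mpol)"
  by (simp add: ihom_def var_def mdeg_def)

lemma ihom_one: "ihom 0 (1 :: ('v, 'k::comm_ring_1) mpol)"
  by (simp add: ihom_def mdeg_def)

lemma ihom_prod_var: "ihom (int (card C)) (\<Prod>v\<in>C. var v :: ('v::finite, 'k::comm_ring_1) mpol)"
  using finite[of C]
proof (induction C)
  case empty
  show ?case by (simp add: ihom_one)
next
  case (insert v C)
  then show ?case using ihom_mult[OF ihom_var insert.IH] by simp
qed

section \<open>Homogeneous components\<close>

definition hcomp :: "int \<Rightarrow> ('v, 'k::zero) mpol \<Rightarrow> ('v, 'k) mpol" where
  "hcomp d p = Abs_poly_mapping (\<lambda>t. if int (mdeg t) = d then Poly_Mapping.lookup p t else 0)"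

lemma lookup_hcomp:
  "Poly_Mapping.lookup (hcomp d p) t = (if int (mdeg t) = d then Poly_Mapping.lookup p t else 0)"
proof -
  have "finite {t. (if int (mdeg t) = d then Poly_Mapping.lookup p t else 0) \<noteq> 0}"
    by (rule finite_subset[OF _ finite_keys[of p]]) (auto simp: in_keys_iff)
  then show ?thesis by (simp add: hcomp_def)
qed

lemma ihom_hcomp: "ihom d (hcomp d p)"
  by (auto simp: ihom_def in_keys_iff lookup_hcomp split: if_splits)

lemma hcomp_ihom: "ihom d p \<Longrightarrow> hcomp d p = p"
  by (rule poly_mapping_eqI) (auto simp: ihom_def in_keys_iff lookup_hcomp)

lemma hcomp_add: "hcomp d (p + q) = hcomp d p + hcomp d q"
  by (rule poly_mapping_eqI) (simp add: lookup_hcomp lookup_add)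

lemma hcomp_sum: "hcomp d (sum f I) = (\<Sum>i\<in>I. hcomp d (f i))"
proof (induction I rule: infinite_finite_induct)
  case (insert x F)
  then show ?case by (simp add: hcomp_add)
qed (auto intro!: poly_mapping_eqI simp: lookup_hcomp)

text \<open>Degrees of monomials add, so the part of \<open>q\<close> outside degree
  \<open>d\<close> contributes nothing in degree \<open>e + d\<close>. With the homogeneous entries
  of a differential as \<open>p\<close>, this allows degree-preserving chain maps to be cut out of
  arbitrary ones.\<close>

lemma hcomp_mult:
  fixes p q :: "('v::finite, 'k::comm_ring_1) mpol"
  assumes "ihom e p"
  shows "hcomp (e + d) (p * q) = p * hcomp d q"
proof (rule poly_mapping_eqI)
  fix t
  define r where "r = q - hcomp d q"
  have q: "q = hcomp d q + r" by (simp add: r_def)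
  have r: "int (mdeg s) \<noteq> d" if "s \<in> Poly_Mapping.keys r" for s
    using that by (auto simp: r_def in_keys_iff lookup_minus lookup_hcomp)
  have "Poly_Mapping.lookup (p * r) t = 0" if "int (mdeg t) = e + d"
  proof (rule ccontr)
    assume "Poly_Mapping.lookup (p * r) t \<noteq> 0"
    then obtain a b where "a \<in> Poly_Mapping.keys p" "b \<in> Poly_Mapping.keys r" "t = a + b"
      using keys_mult[of p r] by (auto simp: in_keys_iff)
    then show False using r that assms by (auto simp: ihom_def mdeg_add)
  qed
  moreover have "Poly_Mapping.lookup (p * hcomp d q) t = 0" if "int (mdeg t) \<noteq> e + d"
    using ihom_mult[OF assms ihom_hcomp[of d q]] that by (auto simp: ihom_def in_keys_iff)
  moreover have "p * q = p * hcomp d q + p * r"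
    by (subst q) (simp add: algebra_simps)
  ultimately show "Poly_Mapping.lookup (hcomp (e + d) (p * q)) t = Poly_Mapping.lookup (p * hcomp d q) t"
    by (auto simp: lookup_hcomp lookup_add)
qed

section \<open>Reduction modulo the variables\<close>

definition const_coeff :: "('v, 'k::zero) mpol \<Rightarrow> 'k" where
  "const_coeff p = Poly_Mapping.lookup p 0"

lemma const_coeff_simps [simp]:
  "const_coeff 0 = 0" "const_coeff (1 :: ('v, 'k::comm_ring_1) mpol) = 1"
  "const_coeff (p + q) = const_coeff p + const_coeff q"
  by (simp_all add: const_coeff_def lookup_add)

lemma const_coeff_diff: "const_coeff (p - q) = const_coeff p - const_coeff q"
  by (simp add: const_coeff_def lookup_minus)

lemma const_coeff_sum: "const_coeff (sum f I) = (\<Sum>i\<in>I. const_coeff (f i))"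
  by (simp add: const_coeff_def lookup_sum)

text \<open>The zero exponent is a sum of exponents only as \<open>0 + 0\<close>. After splitting
  both factors into constant term and remainder, only the product of the constants is left.\<close>

lemma const_coeff_mult:
  fixes p q :: "('v, 'k::comm_ring_1) mpol"
  shows "const_coeff (p * q) = const_coeff p * const_coeff q"
proof -
  have zero: "const_coeff (a * b) = 0" if "const_coeff a = 0" for a b :: "('v, 'k) mpol"
  proof (rule ccontr)
    assume "const_coeff (a * b) \<noteq> 0"
    then obtain s t where s: "s \<in> Poly_Mapping.keys a" and st: "0 = s + t"
      using keys_mult[of a b] by (auto simp: const_coeff_def in_keys_iff)
    have "s = 0"
      using st by (intro poly_mapping_eqI) (metis add_is_0 lookup_add lookup_zero)
    then show False using s that by (simp add: const_coeff_def in_keys_iff)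
  qed
  define c :: "('v, 'k) mpol \<Rightarrow> ('v, 'k) mpol"
    where "c a = Poly_Mapping.single 0 (const_coeff a)" for a
  have c: "const_coeff (a - c a) = 0" for a
    by (simp add: const_coeff_diff c_def) (simp add: const_coeff_def)
  have "p * q = c p * c q + ((p - c p) * q + (q - c q) * c p)"
    by (simp add: algebra_simps)
  then have "const_coeff (p * q) = const_coeff (c p * c q)"
    by (simp only: const_coeff_simps zero[OF c]) simp
  then show ?thesis by (simp add: c_def mult_single) (simp add: const_coeff_def)
qed

text \<open>This is the form in which minimality of a resolution is used: the differentials vanish
  after reduction to the field.\<close>

lemma const_coeff_irrelevant: "p \<in> irrelevant_ideal \<Longrightarrow> const_coeff p = 0"
  unfolding irrelevant_ideal_def
proof (induction rule: ring.span_induct_alt)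
  case base
  then show ?case by simp
next
  case (step c x y)
  moreover have "const_coeff (var v :: ('a, 'b) mpol) = 0" for v
    by (auto simp: const_coeff_def var_def lookup_single when_def poly_mapping_eq_iff fun_eq_iff
        intro!: exI[of _ v])
  ultimately show ?case by (auto simp: const_coeff_mult)
qed

lemma var_irrelevant: "var v \<in> irrelevant_ideal"
  unfolding irrelevant_ideal_def by (rule ring.span_base) simp

text \<open>The ideal is monomial, so each monomial of a polynomial can be treated alone, by
  splitting off one variable of \<open>S\<close>.\<close>

lemma span_var_iff:
  "p \<in> ideal_gen (var ` S) \<longleftrightarrow>
     (\<forall>t\<in>Poly_Mapping.keys p. \<exists>s\<in>S. Poly_Mapping.lookup t s \<noteq> 0)"
  (is "_ \<longleftrightarrow> ?R p") for p :: "('v, 'k::comm_ring_1) mpol"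
proof
  assume "p \<in> ideal_gen (var ` S)"
  then show "?R p"
  proof (induction rule: ring.span_induct_alt)
    case base
    then show ?case by simp
  next
    case (step c x q)
    from step(1) obtain s where s: "s \<in> S" "x = var s" by auto
    have "Poly_Mapping.lookup t s \<noteq> 0" if "t \<in> Poly_Mapping.keys (c * x)" for t
      using keys_mult[of c x] that s by (auto simp: var_def lookup_add split: if_splits)
    then show ?case using step.IH keys_add[of "c * x" q] s by blast
  qed
next
  assume R: "?R p"
  have "Poly_Mapping.single t (Poly_Mapping.lookup p t) \<in> ideal_gen (var ` S)"
    if t: "t \<in> Poly_Mapping.keys p" for t
  proof -
    obtain s where s: "s \<in> S" "Poly_Mapping.lookup t s \<noteq> 0" using R t by blast
    \<comment> \<open>Subtraction of exponents is truncated; it is exact here because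
      \<open>s\<close> occurs in \<open>t\<close>.\<close>
    define u where "u = t - Poly_Mapping.single s 1"
    have "t = u + Poly_Mapping.single s 1"
      using s by (intro poly_mapping_eqI)
        (auto simp: u_def lookup_add lookup_minus lookup_single when_def)
    then have "Poly_Mapping.single t (Poly_Mapping.lookup p t) =
        Poly_Mapping.single u (Poly_Mapping.lookup p t) * var s"
      by (simp add: var_def mult_single)
    then show ?thesis
      using s(1) by (simp only:) (intro ring.span_scale ring.span_base imageI)
  qed
  moreover have "p = (\<Sum>t\<in>Poly_Mapping.keys p. Poly_Mapping.single t (Poly_Mapping.lookup p t))"
    by (rule poly_mapping_eqI)
      (simp add: lookup_sum lookup_single when_def in_keys_iff)
  ultimately show "p \<in> ideal_gen (var ` S)"
    by (metis (no_types, lifting) ring.span_sum)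
qed

lemma lookup_var_mult:
  "Poly_Mapping.lookup (var s * p) (Poly_Mapping.single s 1 + t) = Poly_Mapping.lookup p t"
  for p :: "('v, 'k::comm_ring_1) mpol"
proof -
  define r where "r = p - Poly_Mapping.single t (Poly_Mapping.lookup p t)"
  have r: "Poly_Mapping.lookup r t = 0" by (simp add: r_def lookup_minus)
  have "Poly_Mapping.lookup (var s * r) (Poly_Mapping.single s 1 + t) = 0"
  proof (rule ccontr)
    assume "Poly_Mapping.lookup (var s * r) (Poly_Mapping.single s 1 + t) \<noteq> 0"
    then show False using keys_mult[of "var s" r] r
      by (auto simp: in_keys_iff var_def split: if_splits)
  qed
  moreover have "var s * p =
      Poly_Mapping.single (Poly_Mapping.single s 1 + t) (Poly_Mapping.lookup p t) + var s * r"
    by (simp add: r_def algebra_simps) (simp add: var_def mult_single add.commute)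
  ultimately show ?thesis by (simp add: lookup_add)
qed

text \<open>A variable outside \<open>S\<close> is regular modulo the ideal of \<open>S\<close>,
  since multiplying a monomial by it creates no new divisor from \<open>S\<close>. The Koszul
  induction and the colon ideals of the covers both rest on this.\<close>

lemma span_var_cancel:
  assumes "var s * p \<in> ideal_gen (var ` S)" "s \<notin> S"
  shows "p \<in> ideal_gen (var ` S)"
  unfolding span_var_iff
proof
  fix t assume "t \<in> Poly_Mapping.keys p"
  then have "Poly_Mapping.single s 1 + t \<in> Poly_Mapping.keys (var s * p)"
    by (simp only: in_keys_iff lookup_var_mult) simp
  then obtain u where "u \<in> S" "Poly_Mapping.lookup (Poly_Mapping.single s 1 + t) u \<noteq> 0"
    using assms(1) unfolding span_var_iff by blast
  then show "\<exists>u\<in>S. Poly_Mapping.lookup t u \<noteq> 0"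
    using assms(2) by (intro bexI[of _ u]) (auto simp: lookup_add lookup_single when_def split: if_splits)
qed

lemma span_var_cancel_prod:
  fixes p :: "('v, 'k::comm_ring_1) mpol"
  assumes "finite C" "(\<Prod>v\<in>C. var v) * p \<in> ideal_gen (var ` S)" "C \<inter> S = {}"
  shows "p \<in> ideal_gen (var ` S)"
  using assms
proof (induction C)
  case empty
  then show ?case by simp
next
  case (insert c C)
  have "(\<Prod>v\<in>insert c C. var v) * p = var c * ((\<Prod>v\<in>C. var v) * p)"
    by (simp only: prod.insert[OF insert.hyps] mult.assoc)
  then have "var c * ((\<Prod>v\<in>C. var v) * p) \<in> ideal_gen (var ` S)"
    using insert.prems(1) by (simp only:)
  moreover have "c \<notin> S" using insert.prems(2) by blast
  ultimately have "(\<Prod>v\<in>C. var v) * p \<in> ideal_gen (var ` S)"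
    by (rule span_var_cancel)
  moreover have "C \<inter> S = {}" using insert.prems(2) by blast
  ultimately show ?case by (rule insert.IH)
qed

section \<open>Comparison of projective resolutions\<close>

lemma eq_mat_by_vec:
  assumes "A \<in> carrier_mat nr nc" "B \<in> carrier_mat nr nc"
    and "\<And>v. v \<in> carrier_vec nc \<Longrightarrow> A *\<^sub>v v = B *\<^sub>v (v :: 'r::comm_ring_1 vec)"
  shows "A = B"
proof (rule eq_matI)
  fix i j assume ij: "i < dim_row B" "j < dim_col B"
  have *: "M $$ (i, j) = (M *\<^sub>v unit_vec nc j) $ i" if "M \<in> carrier_mat nr nc" for M :: "'r mat"
  proof -
    have "row M i \<bullet> unit_vec nc j = row M i $ j"
      using that ij assms(2) by (intro scalar_prod_right_unit) auto
    then show ?thesis using that ij assms(2) by simp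
  qed
  show "A $$ (i, j) = B $$ (i, j)"
    using assms(3)[of "unit_vec nc j"] *[OF assms(1)] *[OF assms(2)] by simp
qed (use assms in auto)

section \<open>Submodules, projections and lifting\<close>

lemma vec_submodule_sum:
  assumes "vec_submodule n P" "finite B" "\<And>b. b \<in> B \<Longrightarrow> u b \<in> P"
  shows "vec n (\<lambda>a. \<Sum>b\<in>B. c b * u b $ a) \<in> P"
  using assms(2,3)
proof (induction B)
  case empty
  have "vec n (\<lambda>a. \<Sum>b\<in>{}. c b * u b $ a) = 0\<^sub>v n" by (intro eq_vecI) auto
  then show ?case using assms(1) by (simp add: vec_submodule_def)
next
  case (insert b B)
  have "u b \<in> carrier_vec n" using insert.prems assms(1) by (auto simp: vec_submodule_def)
  then have "vec n (\<lambda>a. \<Sum>b\<in>insert b B. c b * u b $ a) =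
      c b \<cdot>\<^sub>v u b + vec n (\<lambda>a. \<Sum>b\<in>B. c b * u b $ a)"
    using insert.hyps by (intro eq_vecI) auto
  then show ?case using insert assms(1) by (simp add: vec_submodule_def)
qed

lemma mult_mat_vec_in_submodule:
  assumes "vec_submodule n P" "M \<in> carrier_mat n k" "\<And>b. b < k \<Longrightarrow> col M b \<in> P"
    "v \<in> carrier_vec k"
  shows "M *\<^sub>v v \<in> P"
proof -
  have "M *\<^sub>v v = vec n (\<lambda>a. \<Sum>b\<in>{0..<k}. v $ b * col M b $ a)"
    using assms(2,4) by (intro eq_vecI) (auto simp: scalar_prod_def mult.commute)
  then show ?thesis using vec_submodule_sum[OF assms(1), of "{0..<k}" "col M"] assms(3) by simp
qed

lemma direct_summand_submodule: "direct_summand r P \<Longrightarrow> vec_submodule r P"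
  by (simp add: direct_summand_def)

lemma direct_summand_carrier: "direct_summand r P \<Longrightarrow> v \<in> P \<Longrightarrow> v \<in> carrier_vec r"
  by (auto simp: direct_summand_def vec_submodule_def)

lemma direct_summand_carrier_vec: "direct_summand r (carrier_vec r :: 'r::comm_ring_1 vec set)"
proof -
  have "{u + v | u v. u \<in> carrier_vec r \<and> v \<in> {0\<^sub>v r}} = (carrier_vec r :: 'r vec set)"
    by force
  then show ?thesis
    unfolding direct_summand_def
    by (intro conjI exI[of _ "{0\<^sub>v r}"]) (auto simp: vec_submodule_def)
qed

text \<open>\<open>M\<close> is the matrix of the projection onto \<open>P\<close> along a
  complement. Its columns generate \<open>P\<close> and replace a basis, which a projective module
  need not have.\<close>

lemma direct_summand_projection:
  assumes "direct_summand r (P :: 'r::comm_ring_1 vec set)"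
  obtains M where "M \<in> carrier_mat r r" "\<And>b. b < r \<Longrightarrow> col M b \<in> P"
    "\<And>v. v \<in> P \<Longrightarrow> M *\<^sub>v v = v"
proof -
  obtain Q where Q: "vec_submodule r Q" "P \<inter> Q = {0\<^sub>v r}"
    "{u + v | u v. u \<in> P \<and> v \<in> Q} = carrier_vec r"
    using assms by (auto simp: direct_summand_def)
  have P: "vec_submodule r P" using assms by (simp add: direct_summand_def)
  have "\<exists>u v. u \<in> P \<and> v \<in> Q \<and> unit_vec r b = u + v" for b
    using Q(3) by (smt (verit) mem_Collect_eq unit_vec_carrier)
  then obtain p q where pq: "\<And>b. p b \<in> P" "\<And>b. q b \<in> Q" "\<And>b. unit_vec r b = p b + q b"
    by metis
  have carr: "p b \<in> carrier_vec r" "q b \<in> carrier_vec r" for b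
    using pq P Q(1) by (auto simp: vec_submodule_def)
  define M where "M = mat r r (\<lambda>(a, b). p b $ a)"
  define N where "N = mat r r (\<lambda>(a, b). q b $ a)"
  have MN: "M \<in> carrier_mat r r" "N \<in> carrier_mat r r" by (simp_all add: M_def N_def)
  have "col M b = p b" "col N b = q b" if "b < r" for b
    using that carr[of b] by (auto simp: M_def N_def)
  then have cols: "\<And>b. b < r \<Longrightarrow> col M b \<in> P" "\<And>b. b < r \<Longrightarrow> col N b \<in> Q"
    using pq by simp_all
  have "M + N = 1\<^sub>m r"
  proof (rule eq_matI)
    fix i j assume "i < dim_row (1\<^sub>m r)" "j < dim_col (1\<^sub>m r)"
    then show "(M + N) $$ (i, j) = 1\<^sub>m r $$ (i, j)"
      using arg_cong[OF pq(3)[of j], of "\<lambda>v. v $ i"] carr[of j]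
      by (auto simp: M_def N_def)
  qed (auto simp: M_def N_def)
  have "M *\<^sub>v v = v" if v: "v \<in> P" for v
  proof -
    have vc: "v \<in> carrier_vec r" using v P by (auto simp: vec_submodule_def)
    have Mv: "M *\<^sub>v v \<in> P" and Nv: "N *\<^sub>v v \<in> Q"
      using mult_mat_vec_in_submodule[OF P MN(1) cols(1) vc]
        mult_mat_vec_in_submodule[OF Q(1) MN(2) cols(2) vc] by auto
    have sum: "v = M *\<^sub>v v + N *\<^sub>v v"
      using add_mult_distrib_mat_vec[OF MN vc] \<open>M + N = 1\<^sub>m r\<close> vc by simp
    \<comment> \<open>The difference is written with a scalar multiple because a
      \<open>vec_submodule\<close> is closed under sums and scalar multiples. It places the
      complementary part in \<open>P\<close> as well as in \<open>Q\<close>, so that this part is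
      zero.\<close>
    have "N *\<^sub>v v = v + (- 1) \<cdot>\<^sub>v (M *\<^sub>v v)"
    proof (rule eq_vecI)
      fix i assume "i < dim_vec (v + (- 1) \<cdot>\<^sub>v (M *\<^sub>v v))"
      then have i: "i < r" using MN vc by simp
      have "v $ i = (M *\<^sub>v v) $ i + (N *\<^sub>v v) $ i"
        using arg_cong[OF sum, of "\<lambda>v. v $ i"] i MN by simp
      then show "(N *\<^sub>v v) $ i = (v + (- 1) \<cdot>\<^sub>v (M *\<^sub>v v)) $ i"
        using i MN vc by simp
    qed (use MN vc in auto)
    then have "N *\<^sub>v v \<in> P" using P v Mv by (simp add: vec_submodule_def)
    then have "N *\<^sub>v v = 0\<^sub>v r" using Nv Q(2) by blast
    then show ?thesis using sum MN vc by (metis mult_mat_vec_carrier right_zero_vec)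
  qed
  then show ?thesis using that MN(1) cols(1) by blast
qed

text \<open>Preimages are chosen only for the images of the columns of \<open>M\<close>, the
  projection onto \<open>P\<close>. The resulting \<open>L\<close> satisfies
  \<open>D * L = F * M\<close>, and \<open>M\<close> is the identity on \<open>P\<close>.\<close>

lemma lift_through_image:
  fixes P :: "'r::comm_ring_1 vec set"
  assumes P: "direct_summand r P" and P': "vec_submodule t P'"
    and F: "F \<in> carrier_mat s r" and D: "D \<in> carrier_mat s t"
    and im: "\<forall>v\<in>P. F *\<^sub>v v \<in> (\<lambda>u. D *\<^sub>v u) ` P'"
  shows "\<exists>L\<in>carrier_mat t r. \<forall>v\<in>P. L *\<^sub>v v \<in> P' \<and> D *\<^sub>v (L *\<^sub>v v) = F *\<^sub>v v"
proof -
  obtain M where M: "M \<in> carrier_mat r r" "\<And>b. b < r \<Longrightarrow> col M b \<in> P"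
    "\<And>v. v \<in> P \<Longrightarrow> M *\<^sub>v v = v"
    using direct_summand_projection[OF P] by metis
  have "\<forall>b<r. \<exists>u\<in>P'. D *\<^sub>v u = F *\<^sub>v col M b"
    using im M(2) by (metis (no_types, lifting) imageE)
  then obtain u where u: "\<And>b. b < r \<Longrightarrow> u b \<in> P'" "\<And>b. b < r \<Longrightarrow> D *\<^sub>v u b = F *\<^sub>v col M b"
    by metis
  have uc: "u b \<in> carrier_vec t" if "b < r" for b
    using u(1)[OF that] P' by (auto simp: vec_submodule_def)
  define L where "L = mat t r (\<lambda>(a, b). u b $ a)"
  have L: "L \<in> carrier_mat t r" by (simp add: L_def)
  have colL: "col L b = u b" if "b < r" for b
    using uc[OF that] that by (auto simp: L_def)
  have DL: "D * L = F * M"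
  proof (rule mat_col_eqI)
    fix b assume "b < dim_col (F * M)"
    then have b: "b < r" using M(1) by simp
    show "col (D * L) b = col (F * M) b"
      using col_mult2[OF D L b] col_mult2[OF F M(1) b] colL[OF b] u(2)[OF b] by simp
  qed (use L D F M in auto)
  have vc: "v \<in> carrier_vec r" if "v \<in> P" for v using direct_summand_carrier[OF P that] .
  have "L *\<^sub>v v \<in> P' \<and> D *\<^sub>v (L *\<^sub>v v) = F *\<^sub>v v" if "v \<in> P" for v
    using mult_mat_vec_in_submodule[OF P' L _ vc[OF that]] colL u(1)
      assoc_mult_mat_vec[OF D L vc[OF that]] assoc_mult_mat_vec[OF F M(1) vc[OF that]]
      DL M(3)[OF that] by simp
  then show ?thesis using L by blast
qed

text \<open>Level zero has the augmentation in place of a differential. Merging the two cases gives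
  exactness the same form in every degree.\<close>

definition cycles :: "(nat \<Rightarrow> nat) \<Rightarrow> (nat \<Rightarrow> 'r::comm_ring_1 vec set) \<Rightarrow> 'r vec \<Rightarrow>
    (nat \<Rightarrow> 'r mat) \<Rightarrow> nat \<Rightarrow> 'r vec set" where
  "cycles r P eps D i = (case i of
     0 \<Rightarrow> {v \<in> P 0. eps \<bullet> v = 0}
   | Suc k \<Rightarrow> {v \<in> P (Suc k). D k *\<^sub>v v = 0\<^sub>v (r k)})"

lemma projective_resolution_cycles:
  "projective_resolution J r P eps D \<Longrightarrow>
     cycles r P eps D i = (\<lambda>v. D i *\<^sub>v v) ` P (Suc i)"
  by (auto simp: projective_resolution_def cycles_def split: nat.split)

lemma projective_resolutionD:
  assumes "projective_resolution J r P eps D"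
  shows "direct_summand (r i) (P i)" "eps \<in> carrier_vec (r 0)"
    "D i \<in> carrier_mat (r i) (r (Suc i))" "(\<lambda>v. eps \<bullet> v) ` P 0 = J"
proof -
  note a = assms[unfolded projective_resolution_def]
  show "direct_summand (r i) (P i)" by (rule a[THEN conjunct1, THEN spec])
  show "eps \<in> carrier_vec (r 0)" by (rule a[THEN conjunct2, THEN conjunct1])
  show "D i \<in> carrier_mat (r i) (r (Suc i))"
    by (rule a[THEN conjunct2, THEN conjunct2, THEN conjunct1, THEN spec])
  show "(\<lambda>v. eps \<bullet> v) ` P 0 = J"
    by (rule a[THEN conjunct2, THEN conjunct2, THEN conjunct2, THEN conjunct1])
qed

text \<open>All conditions are imposed on vectors of the modules \<open>P i\<close> only, because
  the matrix of a map is arbitrary on a complement of \<open>P i\<close>.\<close>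

definition chain_map :: "(nat \<Rightarrow> nat) \<Rightarrow> (nat \<Rightarrow> 'r::comm_ring_1 vec set) \<Rightarrow> 'r vec \<Rightarrow> (nat \<Rightarrow> 'r mat) \<Rightarrow>
    (nat \<Rightarrow> nat) \<Rightarrow> (nat \<Rightarrow> 'r vec set) \<Rightarrow> 'r vec \<Rightarrow> (nat \<Rightarrow> 'r mat) \<Rightarrow> (nat \<Rightarrow> 'r mat) \<Rightarrow> bool" where
  "chain_map r P eps D r' P' eps' D' F \<longleftrightarrow>
     (\<forall>i. F i \<in> carrier_mat (r' i) (r i)) \<and> (\<forall>i. \<forall>v\<in>P i. F i *\<^sub>v v \<in> P' i) \<and>
     (\<forall>v\<in>P 0. eps' \<bullet> (F 0 *\<^sub>v v) = eps \<bullet> v) \<and>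
     (\<forall>i. \<forall>v\<in>P (Suc i). D' i *\<^sub>v (F (Suc i) *\<^sub>v v) = F i *\<^sub>v (D i *\<^sub>v v))"

text \<open>Comparison theorem: each map is lifted through the next differential. The invariant
  includes that cycles go to cycles, which exactness of the target turns into the hypothesis of the
  next lift.\<close>

lemma chain_map_exists:
  fixes J :: "'r::comm_ring_1 set"
  assumes R: "projective_resolution J r P eps D" and R': "projective_resolution J r' P' eps' D'"
  obtains F where "chain_map r P eps D r' P' eps' D' F"
proof -
  note RD = projective_resolutionD[OF R] and RD' = projective_resolutionD[OF R']
  note cyc = projective_resolution_cycles[OF R] and cyc' = projective_resolution_cycles[OF R']
  let ?Q = "\<lambda>i F. F \<in> carrier_mat (r' i) (r i) \<and> (\<forall>v\<in>P i. F *\<^sub>v v \<in> P' i) \<and>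
    (\<forall>v\<in>cycles r P eps D i. F *\<^sub>v v \<in> cycles r' P' eps' D' i) \<and>
    (i = 0 \<longrightarrow> (\<forall>v\<in>P i. eps' \<bullet> (F *\<^sub>v v) = eps \<bullet> v))"
  let ?S = "\<lambda>i F G. \<forall>v\<in>P (Suc i). D' i *\<^sub>v (G *\<^sub>v v) = F *\<^sub>v (D i *\<^sub>v v)"
  have "\<exists>F. ?Q 0 F"
  proof -
    \<comment> \<open>A vector is viewed as a one-row matrix, so that lifting over the augmentation
      is a case of \<open>lift_through_image\<close>.\<close>
    have row: "mat_of_rows n [e] *\<^sub>v v = vec 1 (\<lambda>_. e \<bullet> v)"
      if "e \<in> carrier_vec n" for e v :: "'r vec" and n
      using that by (intro eq_vecI) auto
    have im: "\<forall>v\<in>P 0. mat_of_rows (r 0) [eps] *\<^sub>v v \<in> (\<lambda>u. mat_of_rows (r' 0) [eps'] *\<^sub>v u) ` P' 0"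
    proof
      fix v assume "v \<in> P 0"
      have "eps \<bullet> v \<in> (\<lambda>v. eps' \<bullet> v) ` P' 0"
        unfolding RD'(4) RD(4)[symmetric] using \<open>v \<in> P 0\<close> by (rule imageI)
      then obtain u where u: "eps \<bullet> v = eps' \<bullet> u" "u \<in> P' 0" by (rule imageE)
      show "mat_of_rows (r 0) [eps] *\<^sub>v v \<in> (\<lambda>u. mat_of_rows (r' 0) [eps'] *\<^sub>v u) ` P' 0"
        unfolding row[OF RD(2)] row[OF RD'(2)] u(1) using u(2) by (rule imageI)
    qed
    have carr: "mat_of_rows (r 0) [eps] \<in> carrier_mat 1 (r 0)"
      "mat_of_rows (r' 0) [eps'] \<in> carrier_mat 1 (r' 0)"
      using mat_of_rows_carrier(1)[of "r 0" "[eps]"] mat_of_rows_carrier(1)[of "r' 0" "[eps']"]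
      by (simp_all only: list.size add_0 One_nat_def)
    have "\<exists>F\<in>carrier_mat (r' 0) (r 0). \<forall>v\<in>P 0. F *\<^sub>v v \<in> P' 0 \<and>
        mat_of_rows (r' 0) [eps'] *\<^sub>v (F *\<^sub>v v) = mat_of_rows (r 0) [eps] *\<^sub>v v"
      using RD(1) direct_summand_submodule[OF RD'(1)] carr im by (rule lift_through_image)
    then obtain F where F: "F \<in> carrier_mat (r' 0) (r 0)"
      "\<forall>v\<in>P 0. F *\<^sub>v v \<in> P' 0 \<and>
        mat_of_rows (r' 0) [eps'] *\<^sub>v (F *\<^sub>v v) = mat_of_rows (r 0) [eps] *\<^sub>v v"
      by (rule bexE)
    have "eps' \<bullet> (F *\<^sub>v v) = eps \<bullet> v" if "v \<in> P 0" for v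
      using arg_cong[OF F(2)[rule_format, OF that, THEN conjunct2], of "\<lambda>u. u $ 0"]
      by (simp add: row[OF RD(2)] row[OF RD'(2)])
    then show ?thesis using F by (intro exI[of _ F]) (simp add: cycles_def)
  qed
  moreover have "\<exists>G. ?Q (Suc i) G \<and> ?S i F G" if "?Q i F" for i F
  proof -
    have F: "F \<in> carrier_mat (r' i) (r i)"
      "\<And>v. v \<in> cycles r P eps D i \<Longrightarrow> F *\<^sub>v v \<in> cycles r' P' eps' D' i"
      using that by auto
    have FD: "F * D i \<in> carrier_mat (r' i) (r (Suc i))" using F(1) RD(3)[of i] by auto
    have assoc: "F * D i *\<^sub>v v = F *\<^sub>v (D i *\<^sub>v v)" if "v \<in> P (Suc i)" for v
      using assoc_mult_mat_vec[OF F(1) RD(3)] direct_summand_carrier[OF RD(1) that] by auto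
    have im: "\<forall>v\<in>P (Suc i). F * D i *\<^sub>v v \<in> (\<lambda>u. D' i *\<^sub>v u) ` P' (Suc i)"
      using F(2) assoc unfolding cyc cyc' by simp
    have "\<exists>G\<in>carrier_mat (r' (Suc i)) (r (Suc i)). \<forall>v\<in>P (Suc i).
        G *\<^sub>v v \<in> P' (Suc i) \<and> D' i *\<^sub>v (G *\<^sub>v v) = F * D i *\<^sub>v v"
      using RD(1) direct_summand_submodule[OF RD'(1)] FD RD'(3) im by (rule lift_through_image)
    then obtain G where G: "G \<in> carrier_mat (r' (Suc i)) (r (Suc i))"
      "\<forall>v\<in>P (Suc i). G *\<^sub>v v \<in> P' (Suc i) \<and> D' i *\<^sub>v (G *\<^sub>v v) = F * D i *\<^sub>v v"
      by (rule bexE)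
    have "G *\<^sub>v v \<in> cycles r' P' eps' D' (Suc i)" if "v \<in> cycles r P eps D (Suc i)" for v
    proof -
      have v: "v \<in> P (Suc i)" "D i *\<^sub>v v = 0\<^sub>v (r i)" using that by (auto simp: cycles_def)
      have "F *\<^sub>v 0\<^sub>v (r i) = 0\<^sub>v (r' i)" using F(1) by (intro eq_vecI) auto
      then show ?thesis using G v assoc by (simp add: cycles_def)
    qed
    then show ?thesis using G assoc by (intro exI[of _ G]) auto
  qed
  ultimately obtain F where "\<forall>i. ?Q i (F i) \<and> ?S i (F i) (F (Suc i))"
    using dependent_nat_choice[of ?Q ?S] by blast
  then have "chain_map r P eps D r' P' eps' D' F" by (simp add: chain_map_def)
  then show ?thesis using that by blast
qed

lemma chain_map_comp:
  assumes "chain_map r P eps D r' P' eps' D' F" "chain_map r' P' eps' D' r'' P'' eps'' D'' G"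
    and "projective_resolution J r P eps D"
  shows "chain_map r P eps D r'' P'' eps'' D'' (\<lambda>i. G i * F i)"
proof -
  note RD = projective_resolutionD[OF assms(3)]
  have F: "F i \<in> carrier_mat (r' i) (r i)" "v \<in> P i \<Longrightarrow> F i *\<^sub>v v \<in> P' i" for i v
    using assms(1) by (auto simp: chain_map_def)
  have G: "G i \<in> carrier_mat (r'' i) (r' i)" for i
    using assms(2) by (auto simp: chain_map_def)
  have assoc: "G i * F i *\<^sub>v v = G i *\<^sub>v (F i *\<^sub>v v)" if "v \<in> P i" for i v
    using assoc_mult_mat_vec[OF G F(1)] direct_summand_carrier[OF RD(1) that] by blast
  have DP: "D i *\<^sub>v v \<in> P i" if "v \<in> P (Suc i)" for i v
    using projective_resolution_cycles[OF assms(3), of i] that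
    by (auto simp: cycles_def split: nat.splits)
  show ?thesis
    using assms(1,2) mult_carrier_mat[OF G F(1)]
    unfolding chain_map_def by (simp add: assoc DP F(2))
qed

text \<open>
  The maps \<open>h\<close> in the induction form a homotopy from the identity to \<open>X\<close>; as the differential
  vanishes modulo the variables, so does \<open>X - 1\<close>.
\<close>

lemma minimal_chain_self_map:
  fixes D :: "nat \<Rightarrow> ('v, 'k::comm_ring_1) mpol mat"
  assumes R: "projective_resolution J r (\<lambda>i. carrier_vec (r i)) eps D"
    and min: "\<And>i a b. a < r i \<Longrightarrow> b < r (Suc i) \<Longrightarrow> const_coeff (D i $$ (a, b)) = 0"
    and X: "chain_map r (\<lambda>i. carrier_vec (r i)) eps D r (\<lambda>i. carrier_vec (r i)) eps D X"
    and ab: "a < r i" "b < r i"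
  shows "const_coeff (X i $$ (a, b)) = (if a = b then 1 else 0)"
proof -
  note RD = projective_resolutionD[OF R]
  have D: "D i \<in> carrier_mat (r i) (r (Suc i))" for i by (rule RD(3))
  have Xc: "X i \<in> carrier_mat (r i) (r i)" for i using X by (simp add: chain_map_def)
  have XD: "D i * X (Suc i) = X i * D i" for i
  proof (rule eq_mat_by_vec[OF mult_carrier_mat[OF D Xc] mult_carrier_mat[OF Xc D]])
    fix v :: "('v, 'k) mpol vec" assume v: "v \<in> carrier_vec (r (Suc i))"
    show "D i * X (Suc i) *\<^sub>v v = X i * D i *\<^sub>v v"
      using X v assoc_mult_mat_vec[OF D Xc v] assoc_mult_mat_vec[OF Xc D v]
      by (simp add: chain_map_def)
  qed
  have DD: "D i * D (Suc i) = 0\<^sub>m (r i) (r (Suc (Suc i)))" for i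
  proof (rule eq_mat_by_vec[OF mult_carrier_mat[OF D D] zero_carrier_mat])
    fix v :: "('v, 'k) mpol vec" assume v: "v \<in> carrier_vec (r (Suc (Suc i)))"
    have "D (Suc i) *\<^sub>v v \<in> cycles r (\<lambda>i. carrier_vec (r i)) eps D (Suc i)"
      using v by (simp add: projective_resolution_cycles[OF R])
    then show "D i * D (Suc i) *\<^sub>v v = 0\<^sub>m (r i) (r (Suc (Suc i))) *\<^sub>v v"
      using assoc_mult_mat_vec[OF D D v] v by (simp add: cycles_def) (intro eq_vecI, auto)
  qed
  \<comment> \<open>A free source is projective, so a map with values in the cycles factors through
    \<open>D i\<close>.\<close>
  have factor: "\<exists>h. h \<in> carrier_mat (r (Suc i)) k \<and> D i * h = Y"
    if Y: "Y \<in> carrier_mat (r i) k"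
      and im: "\<forall>v\<in>carrier_vec k. Y *\<^sub>v v \<in> cycles r (\<lambda>i. carrier_vec (r i)) eps D i"
    for Y k i
  proof -
    have "\<exists>h\<in>carrier_mat (r (Suc i)) k. \<forall>v\<in>carrier_vec k.
        h *\<^sub>v v \<in> carrier_vec (r (Suc i)) \<and> D i *\<^sub>v (h *\<^sub>v v) = Y *\<^sub>v v"
      using direct_summand_carrier_vec direct_summand_submodule[OF RD(1)] Y D
        im[unfolded projective_resolution_cycles[OF R]] by (rule lift_through_image)
    then obtain h where h: "h \<in> carrier_mat (r (Suc i)) k"
      "\<forall>v\<in>carrier_vec k. h *\<^sub>v v \<in> carrier_vec (r (Suc i)) \<and> D i *\<^sub>v (h *\<^sub>v v) = Y *\<^sub>v v"
      by (rule bexE)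
    have "D i * h = Y"
      using h assoc_mult_mat_vec[OF D h(1)] Y
      by (intro eq_mat_by_vec[OF mult_carrier_mat[OF D h(1)] Y]) simp
    then show ?thesis using h by blast
  qed
  \<comment> \<open>Of the homotopy identity \<open>X i - 1 = D i * h + h' * D (i - 1)\<close> only
    the consequence after multiplication by \<open>D i\<close> is kept. It has the same form in
    degree zero, where the second summand is missing.\<close>
  have "\<exists>h. h \<in> carrier_mat (r (Suc i)) (r i) \<and>
      (X i - 1\<^sub>m (r i) - D i * h) * D i = 0\<^sub>m (r i) (r (Suc i)) \<and>
      (\<forall>a<r i. \<forall>b<r i. const_coeff ((X i - 1\<^sub>m (r i)) $$ (a, b)) = 0)"
  proof (induction i)
    case 0
    have carr: "X 0 - 1\<^sub>m (r 0) \<in> carrier_mat (r 0) (r 0)" using Xc by (intro minus_carrier_mat) auto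
    have "(X 0 - 1\<^sub>m (r 0)) *\<^sub>v v \<in> cycles r (\<lambda>i. carrier_vec (r i)) eps D 0"
      if v: "v \<in> carrier_vec (r 0)" for v
    proof -
      have "(X 0 - 1\<^sub>m (r 0)) *\<^sub>v v = X 0 *\<^sub>v v - v"
        using minus_mult_distrib_mat_vec[OF Xc one_carrier_mat v] v by simp
      moreover have "eps \<bullet> (X 0 *\<^sub>v v - v) = eps \<bullet> (X 0 *\<^sub>v v) - eps \<bullet> v"
        using RD(2) mult_mat_vec_carrier[OF Xc v] v by (rule scalar_prod_minus_distrib)
      moreover have "eps \<bullet> (X 0 *\<^sub>v v) = eps \<bullet> v" using X v by (simp add: chain_map_def)
      ultimately show ?thesis using mult_mat_vec_carrier[OF Xc v] v by (simp add: cycles_def)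
    qed
    then obtain h where h: "h \<in> carrier_mat (r (Suc 0)) (r 0)" "D 0 * h = X 0 - 1\<^sub>m (r 0)"
      using factor[OF carr] by meson
    have "const_coeff ((X 0 - 1\<^sub>m (r 0)) $$ (a, b)) = 0" if "a < r 0" "b < r 0" for a b
      using that h D[of 0] min
      by (auto simp: h(2)[symmetric] scalar_prod_def const_coeff_sum const_coeff_mult
          simp del: index_minus_mat)
    moreover have "(X 0 - 1\<^sub>m (r 0) - D 0 * h) * D 0 = 0\<^sub>m (r 0) (r (Suc 0))"
      unfolding h(2) using carr D[of 0] by (simp add: left_mult_zero_mat)
    ultimately show ?case using h by blast
  next
    case (Suc i)
    then obtain h where h: "h \<in> carrier_mat (r (Suc i)) (r i)"
      "(X i - 1\<^sub>m (r i) - D i * h) * D i = 0\<^sub>m (r i) (r (Suc i))" by blast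
    note c = D[of i] D[of "Suc i"] Xc[of i] Xc[of "Suc i"] h(1)
    \<comment> \<open>\<open>Y\<close> is \<open>X (Suc i) - 1\<close> without the summand of the
      previous homotopy. The induction hypothesis makes \<open>D i\<close> kill it, so it factors
      through the next differential, which gives the new homotopy \<open>g\<close>.\<close>
    define Y where "Y = X (Suc i) - 1\<^sub>m (r (Suc i)) - h * D i"
    have hD: "h * D i \<in> carrier_mat (r (Suc i)) (r (Suc i))" using c by auto
    have Yc: "Y \<in> carrier_mat (r (Suc i)) (r (Suc i))"
      unfolding Y_def using hD by (rule minus_carrier_mat)
    have X1: "X j - 1\<^sub>m (r j) \<in> carrier_mat (r j) (r j)" for j
      by (rule minus_carrier_mat) simp
    have Dh: "D i * h \<in> carrier_mat (r i) (r i)" using c by auto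
    have "D i * Y = D i * X (Suc i) - D i * 1\<^sub>m (r (Suc i)) - D i * (h * D i)"
      unfolding Y_def mult_minus_distrib_mat[OF D X1 hD]
        mult_minus_distrib_mat[OF D Xc one_carrier_mat] ..
    also have "\<dots> = X i * D i - 1\<^sub>m (r i) * D i - D i * h * D i"
      using c by (simp add: XD)
    also have "\<dots> = (X i - 1\<^sub>m (r i) - D i * h) * D i"
      unfolding minus_mult_distrib_mat[OF X1 Dh D] minus_mult_distrib_mat[OF Xc one_carrier_mat D] ..
    finally have DY: "D i * Y = 0\<^sub>m (r i) (r (Suc i))" using h by simp
    have "Y *\<^sub>v v \<in> cycles r (\<lambda>i. carrier_vec (r i)) eps D (Suc i)"
      if v: "v \<in> carrier_vec (r (Suc i))" for v
    proof -
      have "D i *\<^sub>v (Y *\<^sub>v v) = 0\<^sub>m (r i) (r (Suc i)) *\<^sub>v v"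
        using assoc_mult_mat_vec[OF D Yc v] DY by simp
      also have "\<dots> = 0\<^sub>v (r i)" using v by (intro eq_vecI) auto
      finally show ?thesis using mult_mat_vec_carrier[OF Yc v] by (simp add: cycles_def)
    qed
    then obtain g where g: "g \<in> carrier_mat (r (Suc (Suc i))) (r (Suc i))" "D (Suc i) * g = Y"
      using factor[OF Yc] by meson
    have *: "X (Suc i) - 1\<^sub>m (r (Suc i)) = h * D i + D (Suc i) * g"
      unfolding g(2) Y_def using c by (intro eq_matI) auto
    have "X (Suc i) - 1\<^sub>m (r (Suc i)) - D (Suc i) * g = h * D i"
      unfolding g(2) Y_def using c by (intro eq_matI) auto
    then have "(X (Suc i) - 1\<^sub>m (r (Suc i)) - D (Suc i) * g) * D (Suc i) =
        0\<^sub>m (r (Suc i)) (r (Suc (Suc i)))"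
      using c by (simp add: assoc_mult_mat[OF h(1) D D] DD right_mult_zero_mat)
    moreover have "const_coeff ((X (Suc i) - 1\<^sub>m (r (Suc i))) $$ (a, b)) = 0"
      if "a < r (Suc i)" "b < r (Suc i)" for a b
      unfolding * using that c g(1) min
      by (auto simp: scalar_prod_def const_coeff_sum const_coeff_mult)
    ultimately show ?case using g(1) by blast
  qed
  then have "const_coeff ((X i - 1\<^sub>m (r i)) $$ (a, b)) = 0" using ab by blast
  then show ?thesis using ab Xc[of i] by (auto simp: const_coeff_diff)
qed

section \<open>The Koszul complex on variables\<close>

text \<open>The order of \<open>to_nat\<close> serves as an arbitrary linear order on the vertices;
  the sign is that of moving \<open>s\<close> to its place in \<open>T\<close>.\<close>

definition ksgn :: "'v::finite \<Rightarrow> 'v set \<Rightarrow> 'r::comm_ring_1" where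
  "ksgn s T = (- 1) ^ card {t \<in> T. to_nat t < to_nat s}"

lemma ksgn_square: "ksgn s T * ksgn s T = 1"
  by (simp add: ksgn_def flip: power_mult_distrib)

lemma ksgn_insert:
  assumes "t \<notin> T"
  shows "ksgn s (insert t T) = (if to_nat t < to_nat s then - ksgn s T else ksgn s T)"
proof -
  have "{u \<in> insert t T. to_nat u < to_nat s} =
      (if to_nat t < to_nat s then insert t {u \<in> T. to_nat u < to_nat s} else {u \<in> T. to_nat u < to_nat s})"
    by auto
  then show ?thesis using assms by (simp add: ksgn_def)
qed

text \<open>Exactly one of the two vertices precedes the other, so exactly one of the two signs
  changes when the other vertex is inserted.\<close>

lemma ksgn_anticommute:
  assumes "s \<noteq> t" "s \<notin> T" "t \<notin> T"
  shows "ksgn s T * ksgn t (insert s T) = - (ksgn t T * ksgn s (insert t T) :: 'r::comm_ring_1)"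
proof -
  have "to_nat s \<noteq> to_nat t" using assms(1) by simp
  then consider "to_nat s < to_nat t" | "to_nat t < to_nat s" by linarith
  then show ?thesis
    by cases (simp_all add: ksgn_insert[OF assms(2)] ksgn_insert[OF assms(3)] mult.commute[of "ksgn s T"])
qed

text \<open>\<open>f\<close> holds the coefficients of a chain whose basis elements are subsets of
  \<open>S\<close>, and the sum is the coefficient of its boundary at \<open>T\<close>. Hence it
  runs over the sets with one element more.\<close>

definition koszul :: "'v::finite set \<Rightarrow> ('v set \<Rightarrow> ('v, 'k::field) mpol) \<Rightarrow> 'v set \<Rightarrow> ('v, 'k) mpol" where
  "koszul S f T = (\<Sum>s\<in>S - T. ksgn s T * var s * f (insert s T))"

lemma koszul_cong: "(\<And>T. T \<subseteq> S \<Longrightarrow> f T = g T) \<Longrightarrow> T \<subseteq> S \<Longrightarrow> koszul S f T = koszul S g T"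
  unfolding koszul_def by (intro sum.cong) auto

lemma koszul_insert:
  assumes "s \<notin> S" "T \<subseteq> S"
  shows "koszul (insert s S) f T = var s * (ksgn s T * f (insert s T)) + koszul S f T"
proof -
  have "insert s S - T = insert s (S - T)" using assms by auto
  then show ?thesis using assms by (simp add: koszul_def mult_ac)
qed

text \<open>Together with \<open>koszul_insert\<close> this presents the complex on
  \<open>insert s S\<close> as the mapping cone of multiplication by \<open>var s\<close> on the
  complex on \<open>S\<close>. The factor \<open>ksgn s T\<close> normalises the half of a chain
  that lives on sets containing \<open>s\<close>.\<close>

lemma koszul_insert_insert:
  fixes f :: "'v::finite set \<Rightarrow> ('v, 'k::field) mpol"
  assumes "s \<notin> S" "T \<subseteq> S"
  shows "koszul (insert s S) f (insert s T) = - (ksgn s T * koszul S (\<lambda>T. ksgn s T * f (insert s T)) T)"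
proof -
  have "insert s S - insert s T = S - T" using assms by auto
  moreover have "ksgn t (insert s T) * var t * f (insert t (insert s T)) =
      - (ksgn s T * (ksgn t T * var t * (ksgn s (insert t T) * f (insert s (insert t T)))))"
    if t: "t \<in> S - T" for t
  proof -
    have st: "t \<noteq> s" "t \<notin> T" "s \<notin> T" using t assms by auto
    have "ksgn s T * ksgn t T * ksgn s (insert t T) =
        - (ksgn s T * ksgn s T * ksgn t (insert s T) :: ('v, 'k) mpol)"
      by (simp only: mult.assoc ksgn_anticommute[OF st] mult_minus_right)
    then have *: "ksgn t (insert s T) = - (ksgn s T * ksgn t T * ksgn s (insert t T) :: ('v, 'k) mpol)"
      by (simp add: ksgn_square)
    show ?thesis unfolding * by (simp add: mult_ac insert_commute)
  qed
  ultimately show ?thesis by (simp add: koszul_def sum_distrib_left sum_negf)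
qed

lemma koszul_uminus: "koszul S (\<lambda>T. - f T) T = - koszul S f T"
  by (simp add: koszul_def sum_negf)

lemma koszul_linear: "koszul S (\<lambda>T. f T - c * g T) T = koszul S f T - c * koszul S g T"
  by (simp add: koszul_def sum_subtractf sum_distrib_left algebra_simps)

text \<open>
  Chains of all degrees are treated at once: the cycles of positive degree and the elements
  \<open>f {}\<close> of the ideal are exactly the boundaries.
\<close>

lemma koszul_exact:
  fixes f :: "'v::finite set \<Rightarrow> ('v, 'k::field) mpol"
  assumes "\<And>T. T \<subseteq> S \<Longrightarrow> koszul S f T = 0" "f {} \<in> ideal_gen (var ` S)"
  shows "\<exists>g. \<forall>T\<subseteq>S. f T = koszul S g T"
  using finite[of S] assms
proof (induction S arbitrary: f)
  case empty
  then show ?case by (simp add: koszul_def)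
next
  case (insert s S)
  note s = insert.hyps(2)
  \<comment> \<open>The half of \<open>f\<close> on sets containing \<open>s\<close>, made into a
    chain on \<open>S\<close>. It turns out to be a cycle there.\<close>
  define b where "b T = ksgn s T * f (insert s T)" for T
  have fb: "var s * b T + koszul S f T = 0" if "T \<subseteq> S" for T
    using insert.prems(1)[of T] koszul_insert[OF s that, of f] that by (auto simp: b_def)
  have bcyc: "koszul S b T = 0" if "T \<subseteq> S" for T
  proof -
    have "ksgn s T * koszul S b T = 0"
      using insert.prems(1)[of "insert s T"] koszul_insert_insert[OF s that, of f] that
      by (auto simp: b_def[abs_def])
    then have "ksgn s T * ksgn s T * koszul S b T = 0" by (simp add: mult.assoc)
    then show ?thesis by (simp add: ksgn_square)
  qed
  have Kf: "koszul S f {} \<in> ideal_gen (var ` S)"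
    unfolding koszul_def
  proof (rule ring.span_sum)
    fix t assume t: "t \<in> S - {}"
    have "ksgn t {} * var t * f {t} = (ksgn t {} * f {t}) * var t" by (simp add: mult_ac)
    then show "ksgn t {} * var t * f {t} \<in> ideal_gen (var ` S)"
      using t by (simp only:) (intro ring.span_scale ring.span_base, simp)
  qed
  \<comment> \<open>The cycle condition at the empty set puts \<open>var s * b {}\<close> into the
    ideal of \<open>S\<close>, and \<open>var s\<close> can be cancelled there.\<close>
  have "var s * b {} = - koszul S f {}" using fb[of "{}"] by (simp add: eq_neg_iff_add_eq_0)
  then have "var s * b {} \<in> ideal_gen (var ` S)" using ring.span_neg[OF Kf] by (simp only:)
  then have b0: "b {} \<in> ideal_gen (var ` S)" using s by (rule span_var_cancel)
  have "\<exists>c. \<forall>T\<subseteq>S. b T = koszul S c T"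
  proof (rule insert.IH)
    show "koszul S b T = 0" if "T \<subseteq> S" for T using that by (rule bcyc)
  qed (rule b0)
  then obtain c where "\<forall>T\<subseteq>S. b T = koszul S c T" by (rule exE)
  note c = this[rule_format]
  obtain q where q: "f {} - q * var s \<in> ideal_gen (var ` S)"
    using insert.prems(2) by (auto simp: ring.span_insert)
  \<comment> \<open>The boundary never reads a chain at the empty set, so the value of
    \<open>e\<close> there is free. The choice \<open>q\<close> puts \<open>a {}\<close> into the
    ideal of \<open>S\<close>.\<close>
  define e where "e T = (if T = {} then q else - c T)" for T
  have e: "koszul S e T = - b T" if "T \<subseteq> S" for T
    unfolding c[OF that] koszul_uminus[symmetric] by (simp add: koszul_def e_def)
  \<comment> \<open>Since \<open>e\<close> has boundary \<open>- b\<close>, subtracting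
    \<open>var s * e\<close> turns the half of \<open>f\<close> without \<open>s\<close> into a
    cycle on \<open>S\<close>.\<close>
  define a where "a T = f T - var s * e T" for T
  have acyc: "koszul S a T = 0" if "T \<subseteq> S" for T
    using fb[OF that] e[OF that] by (simp add: a_def[abs_def] koszul_linear add.commute)
  have a0: "a {} \<in> ideal_gen (var ` S)" using q by (simp add: a_def e_def mult.commute)
  have "\<exists>a'. \<forall>T\<subseteq>S. a T = koszul S a' T"
  proof (rule insert.IH)
    show "koszul S a T = 0" if "T \<subseteq> S" for T using that by (rule acyc)
  qed (rule a0)
  then obtain a' where "\<forall>T\<subseteq>S. a T = koszul S a' T" by (rule exE)
  note a' = this[rule_format]
  \<comment> \<open>The preimage is glued from \<open>e\<close> on the sets containing
    \<open>s\<close>, with the sign restored, and \<open>a'\<close> on the others.\<close>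
  define g where "g T = (if s \<in> T then ksgn s (T - {s}) * e (T - {s}) else a' T)" for T
  have gs: "ksgn s T * g (insert s T) = e T" if "T \<subseteq> S" for T
  proof -
    have "insert s T - {s} = T" using that s by auto
    then show ?thesis by (simp add: g_def mult.assoc[symmetric] ksgn_square)
  qed
  have ga: "g T = a' T" if "T \<subseteq> S" for T using that s by (auto simp: g_def)
  have "f T = koszul (insert s S) g T" if T: "T \<subseteq> insert s S" for T
  proof (cases "s \<in> T")
    case False
    then have T': "T \<subseteq> S" using T by auto
    have "koszul S g T = a T" using koszul_cong[of S g a' T, OF ga T'] a'[OF T'] by simp
    then show ?thesis unfolding koszul_insert[OF s T'] gs[OF T'] by (simp add: a_def)
  next
    case True
    define U where "U = T - {s}"
    have U: "U \<subseteq> S" "T = insert s U" using T True by (auto simp: U_def)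
    have "koszul S (\<lambda>T. ksgn s T * g (insert s T)) U = - b U"
      using koszul_cong[OF gs U(1)] e[OF U(1)] by simp
    then have "koszul (insert s S) g T = ksgn s U * b U"
      unfolding U(2) koszul_insert_insert[OF s U(1)] by simp
    also have "\<dots> = f T" by (simp add: b_def U(2) mult.assoc[symmetric] ksgn_square)
    finally show ?thesis ..
  qed
  then show ?case by blast
qed


section \<open>The cubical complex of a family closed under swaps\<close>

text \<open>The terms cancel in pairs. Peeling off one element at a time avoids a division by two,
  which characteristic two forbids.\<close>

lemma antisymmetric_sum_zero:
  fixes F :: "'a \<Rightarrow> 'a \<Rightarrow> 'r::ab_group_add"
  assumes "finite A" "\<And>s t. s \<in> A \<Longrightarrow> t \<in> A \<Longrightarrow> s \<noteq> t \<Longrightarrow> F s t = - F t s"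
  shows "(\<Sum>s\<in>A. \<Sum>t\<in>A - {s}. F s t) = 0"
  using assms
proof (induction A)
  case (insert a A)
  have "(\<Sum>t\<in>insert a A - {s}. F s t) = F s a + (\<Sum>t\<in>A - {s}. F s t)" if "s \<in> A" for s
  proof -
    have "insert a A - {s} = insert a (A - {s})" using that insert.hyps by auto
    then show ?thesis using insert.hyps by simp
  qed
  then have "(\<Sum>s\<in>insert a A. \<Sum>t\<in>insert a A - {s}. F s t) =
      (\<Sum>t\<in>A. F a t + F t a) + (\<Sum>s\<in>A. \<Sum>t\<in>A - {s}. F s t)"
    using insert.hyps by (simp add: sum.distrib algebra_simps)
  also have "(\<Sum>t\<in>A. F a t + F t a) = 0"
  proof (rule sum.neutral, rule ballI)
    fix t assume "t \<in> A"
    then have "F a t = - F t a" using insert.hyps(2) by (intro insert.prems) auto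
    then show "F a t + F t a = 0" by simp
  qed
  also have "(\<Sum>s\<in>A. \<Sum>t\<in>A - {s}. F s t) = 0"
  proof (rule insert.IH)
    show "F s t = - F t s" if "s \<in> A" "t \<in> A" "s \<noteq> t" for s t
      using that by (intro insert.prems) simp_all
  qed
  finally show ?case by simp
qed simp

definition cover_monomial :: "'v set \<Rightarrow> ('v, 'k::field) mpol" where
  "cover_monomial C = (\<Prod>v\<in>C. var v)"

text \<open>The combinatorics of minimal covers on which the resolution rests: a member is
  determined by its trace on \<open>V'\<close>, and it can be moved towards \<open>V'\<close> one
  vertex at a time. Closure is demanded only for swaps into \<open>V'\<close>.\<close>

locale swap_family =
  fixes V' :: "'v::finite set" and om :: "'v \<Rightarrow> 'v" and M :: "'v set set"
  assumes om_notin: "v \<in> V' \<Longrightarrow> om v \<notin> V'"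
    and decomp: "C \<in> M \<Longrightarrow> C = (C \<inter> V') \<union> om ` (V' - C)"
    and om_inj: "C \<in> M \<Longrightarrow> inj_on om (V' - C)"
    and swap: "C \<in> M \<Longrightarrow> s \<in> V' - C \<Longrightarrow> insert s (C - {om s}) \<in> M"
begin

lemma om_in: "C \<in> M \<Longrightarrow> s \<in> V' \<Longrightarrow> s \<notin> C \<Longrightarrow> om s \<in> C"
  using decomp by blast

text \<open>\<open>om\<close> matches the vertices of \<open>V'\<close> missing from
  \<open>C\<close> with the vertices of \<open>C\<close> outside \<open>V'\<close>. All generators
  thus have the same degree.\<close>

lemma card_eq: assumes "C \<in> M" shows "card C = card V'"
proof -
  have "(C \<inter> V') \<inter> om ` (V' - C) = {}" using om_notin by auto
  then have "card C = card (C \<inter> V') + card (om ` (V' - C))"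
    using decomp[OF assms] by (metis card_Un_disjoint finite)
  also have "\<dots> = card (C \<inter> V') + card (V' - C)" by (simp add: card_image om_inj[OF assms])
  also have "\<dots> = card V'"
    using card_Int_Diff[of V' C] by (simp add: Int_commute)
  finally show ?thesis .
qed

text \<open>Otherwise \<open>V' - C\<close> would be contained in \<open>V' - D\<close> and equal to
  it by size, and a member of \<open>M\<close> is determined by its trace. The vertex found shows
  that a generator of no higher level lies in the ideal of the variables in
  \<open>V' - C\<close>.\<close>

lemma level_witness:
  assumes "C \<in> M" "D \<in> M" "D \<noteq> C" "card (V' - D) \<le> card (V' - C)"
  shows "\<exists>v\<in>D. v \<in> V' - C"
proof (rule ccontr)
  assume "\<not> ?thesis"
  then have "V' - C \<subseteq> V' - D" by auto
  then have eq: "V' - C = V' - D" using assms(4) by (intro card_subset_eq) (auto dest: card_mono[rotated])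
  then have "C \<inter> V' = D \<inter> V'" by blast
  then show False using decomp[OF assms(1)] decomp[OF assms(2)] eq assms(3) by metis
qed

definition cells :: "('v set \<times> 'v set) set" where
  "cells = {(T, C). C \<in> M \<and> T \<subseteq> V' - C}"

text \<open>Chains are total functions vanishing off the cells, so that chains of all dimensions
  share one type.\<close>

definition supported :: "('v set \<times> 'v set \<Rightarrow> ('v, 'k::field) mpol) \<Rightarrow> bool" where
  "supported f \<longleftrightarrow> (\<forall>c. c \<notin> cells \<longrightarrow> f c = 0)"

text \<open>The inverse of the swap of \<open>C\<close> to \<open>insert s (C - {om s})\<close>.\<close>

definition unswap :: "'v \<Rightarrow> 'v set \<Rightarrow> 'v set" where
  "unswap s D = insert (om s) (D - {s})"

text \<open>The coefficient at \<open>D\<close> of the two faces in direction \<open>s\<close>: one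
  comes from a cell with cover \<open>D\<close>, the other from a cell whose cover is swapped to
  \<open>D\<close>, which requires that \<open>D\<close> contains \<open>s\<close> but not
  \<open>om s\<close>.\<close>

definition edge_op :: "'v \<Rightarrow> ('v set \<Rightarrow> ('v, 'k::field) mpol) \<Rightarrow> 'v set \<Rightarrow> ('v, 'k) mpol" where
  "edge_op s g D =
     var s * g D - (if s \<in> D \<and> om s \<notin> D then var (om s) * g (unswap s D) else 0)"

text \<open>
  The cell \<open>(T, C)\<close> is a cube whose vertices are obtained from \<open>C\<close> by swapping \<open>om s\<close> for \<open>s\<close>
  for the elements \<open>s\<close> of a subset of \<open>T\<close>; in direction \<open>s\<close> it has the two faces
  \<open>(T - {s}, C)\<close> and \<open>(T - {s}, insert s (C - {om s}))\<close>.
\<close>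

definition bd :: "('v set \<times> 'v set \<Rightarrow> ('v, 'k::field) mpol) \<Rightarrow> 'v set \<times> 'v set \<Rightarrow> ('v, 'k) mpol" where
  "bd f c = (case c of (T, D) \<Rightarrow>
     \<Sum>s\<in>V' - T. ksgn s T * edge_op s (\<lambda>D. f (insert s T, D)) D)"

definition aug :: "('v set \<times> 'v set \<Rightarrow> ('v, 'k::field) mpol) \<Rightarrow> ('v, 'k) mpol" where
  "aug f = (\<Sum>C\<in>M. cover_monomial C * f ({}, C))"

section \<open>Linearity of the boundary and the augmentation\<close>

lemma edge_op_sum: "edge_op s (\<lambda>D. \<Sum>t\<in>A. c t * g t D) D = (\<Sum>t\<in>A. c t * edge_op s (g t) D)"
  by (cases "s \<in> D"; cases "om s \<in> D")
    (simp_all add: edge_op_def sum_distrib_left right_diff_distrib sum_subtractf mult_ac)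

lemma edge_op_diff: "edge_op s (\<lambda>D. g D - h D) D = edge_op s g D - edge_op s h D"
  by (simp add: edge_op_def algebra_simps)

lemma bd_sum: "bd (\<lambda>c. \<Sum>t\<in>A. x t * g t c) c = (\<Sum>t\<in>A. x t * bd (g t) c)"
  by (cases c) (simp add: bd_def edge_op_sum sum_distrib_left mult_ac, rule sum.swap)

lemma bd_diff: "bd (\<lambda>c. f c - g c) c = bd f c - bd g c"
  by (cases c) (simp add: bd_def edge_op_diff right_diff_distrib sum_subtractf)

lemma bd_zero: "bd (\<lambda>_. 0) c = 0"
  by (cases c) (auto simp: bd_def edge_op_def intro!: sum.neutral)

lemma aug_diff: "aug (\<lambda>c. f c - g c) = aug f - aug g"
  by (simp add: aug_def right_diff_distrib sum_subtractf)

text \<open>\<open>D\<close> is the swap of \<open>unswap s D\<close>, so closure under swaps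
  applies. It makes the second face of a cell a cell again.\<close>

lemma unswap_cell:
  assumes "(insert s T, unswap s D) \<in> cells" "s \<notin> T" "s \<in> D" "om s \<notin> D"
  shows "(T, D) \<in> cells"
proof -
  let ?C = "unswap s D"
  have C: "?C \<in> M" "insert s T \<subseteq> V' - ?C" using assms(1) by (auto simp: cells_def)
  then have "insert s (?C - {om s}) \<in> M" using swap by auto
  moreover have "insert s (?C - {om s}) = D" using assms(3,4) by (auto simp: unswap_def)
  ultimately have "D \<in> M" by simp
  moreover have "T \<subseteq> V' - D" using C(2) assms(2) by (auto simp: unswap_def)
  ultimately show ?thesis by (simp add: cells_def)
qed

lemma supported_bd:
  assumes "supported f"
  shows "supported (bd f)"
  unfolding supported_def
proof (intro allI impI)
  fix c assume c: "c \<notin> cells"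
  obtain T D where TD: "c = (T, D)" by (cases c)
  have "edge_op s (\<lambda>D. f (insert s T, D)) D = 0" if s: "s \<in> V' - T" for s
  proof -
    have "(insert s T, D) \<notin> cells" using c by (auto simp: TD cells_def)
    moreover have "(insert s T, unswap s D) \<notin> cells" if "s \<in> D" "om s \<notin> D"
      using unswap_cell[of s T D] that s c by (auto simp: TD)
    ultimately show ?thesis using assms by (auto simp: edge_op_def supported_def)
  qed
  then show "bd f c = 0" by (simp add: bd_def TD)
qed

text \<open>Exchanges with different partners act on different vertices. If
  \<open>om s = om t\<close>, injectivity of \<open>om\<close> on \<open>V' - C\<close> excludes
  members that miss both \<open>s\<close> and \<open>t\<close>, and \<open>g\<close> is
  zero.\<close>

lemma edge_op_commute:
  assumes "s \<in> V'" "t \<in> V'" "s \<noteq> t" "\<And>C. g C \<noteq> 0 \<Longrightarrow> C \<in> M \<and> s \<notin> C \<and> t \<notin> C"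
  shows "edge_op s (edge_op t g) D = edge_op t (edge_op s g) D"
proof (cases "om s = om t")
  case True
  have "g C = 0" for C
    using assms True om_inj[of C] by (metis DiffI inj_on_def)
  then show ?thesis by (simp add: edge_op_def)
next
  case False
  have "om s \<noteq> s" "om s \<noteq> t" "om t \<noteq> s" "om t \<noteq> t" using om_notin assms(1,2) by metis+
  moreover from this have "unswap s (unswap t D) = unswap t (unswap s D)"
    using assms(3) by (auto simp: unswap_def)
  moreover have "s \<in> unswap t D \<longleftrightarrow> s \<in> D" "om s \<in> unswap t D \<longleftrightarrow> om s \<in> D"
    "t \<in> unswap s D \<longleftrightarrow> t \<in> D" "om t \<in> unswap s D \<longleftrightarrow> om t \<in> D"
    using calculation False assms(3) by (auto simp: unswap_def)
  ultimately show ?thesis by (simp add: edge_op_def algebra_simps)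
qed

text \<open>The operators of two directions commute while their signs anticommute, so the two orders
  of passing to a face of codimension two cancel.\<close>

lemma bd_bd:
  fixes f :: "'v set \<times> 'v set \<Rightarrow> ('v, 'k::field) mpol"
  assumes "supported f"
  shows "bd (bd f) c = 0"
proof -
  obtain T D where TD: "c = (T, D)" by (cases c)
  define U where "U s t = edge_op s (edge_op t (\<lambda>D. f (insert t (insert s T), D))) D" for s t
  have sym: "U s t = U t s" if "s \<in> V'" "t \<in> V'" "s \<noteq> t" for s t
    unfolding U_def insert_commute[of t s]
    using that assms by (intro edge_op_commute) (auto simp: supported_def cells_def)
  have "bd (bd f) c = (\<Sum>s\<in>V' - T. \<Sum>t\<in>V' - T - {s}. ksgn s T * ksgn t (insert s T) * U s t)"
  proof -
    have *: "V' - insert s T = V' - T - {s}" for s by auto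
    show ?thesis
      unfolding TD bd_def prod.case edge_op_sum * U_def
      by (simp add: sum_distrib_left mult.assoc)
  qed
  also have "\<dots> = 0"
  proof (rule antisymmetric_sum_zero)
    fix s t assume st: "s \<in> V' - T" "t \<in> V' - T" "s \<noteq> t"
    then have "ksgn s T * ksgn t (insert s T) = - (ksgn t T * ksgn s (insert t T) :: ('v, 'k) mpol)"
      by (intro ksgn_anticommute) auto
    then show "ksgn s T * ksgn t (insert s T) * U s t = - (ksgn t T * ksgn s (insert t T) * U t s)"
      using sym[of s t] st by simp
  qed simp
  finally show ?thesis .
qed

lemma cover_monomial_insert: "v \<notin> C \<Longrightarrow> cover_monomial (insert v C) = var v * cover_monomial C"
  for C :: "'v set" by (simp add: cover_monomial_def)

text \<open>Each direction cancels alone, because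
  \<open>var s * cover_monomial C = var (om s) * cover_monomial C'\<close> for the swap
  \<open>C'\<close> of \<open>C\<close>.\<close>

lemma aug_bd:
  fixes f :: "'v set \<times> 'v set \<Rightarrow> ('v, 'k::field) mpol"
  assumes "supported f"
  shows "aug (bd f) = 0"
proof -
  have "(\<Sum>D\<in>M. cover_monomial D * edge_op s (\<lambda>D. f ({s}, D)) D) = 0" if s: "s \<in> V'" for s
  proof -
    define g where "g D = f ({s}, D)" for D
    have g: "C \<in> M \<and> s \<notin> C" if "g C \<noteq> 0" for C
      using that assms by (auto simp: g_def supported_def cells_def)
    let ?h = "\<lambda>D. cover_monomial D * (var (om s) * g (unswap s D))"
    have "(\<Sum>D\<in>M. cover_monomial D * (var s * g D)) =
        (\<Sum>D\<in>{D \<in> M. s \<notin> D}. cover_monomial D * (var s * g D))"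
    proof (rule sum.mono_neutral_right)
      have "g D = 0" if "s \<in> D" for D using g that by blast
      then show "\<forall>D\<in>M - {D \<in> M. s \<notin> D}. cover_monomial D * (var s * g D) = 0" by simp
    qed auto
    \<comment> \<open>The substitution is the swap. A member containing \<open>s\<close> but not
      \<open>om s\<close> need not arise from it, hence the condition that unswapping leads back
      into \<open>M\<close>.\<close>
    also have "\<dots> = (\<Sum>D\<in>{D \<in> M. s \<in> D \<and> om s \<notin> D \<and> unswap s D \<in> M}. ?h D)"
    proof (rule sum.reindex_bij_witness[where i = "unswap s" and j = "\<lambda>C. insert s (C - {om s})"])
      have ne: "om s \<noteq> s" using om_notin s by metis
      fix C assume "C \<in> {D \<in> M. s \<notin> D}"
      then have C: "C \<in> M" "s \<notin> C" "om s \<in> C" using om_in s by auto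
      show inv: "unswap s (insert s (C - {om s})) = C"
        using C ne by (auto simp: unswap_def)
      show "insert s (C - {om s}) \<in> {D \<in> M. s \<in> D \<and> om s \<notin> D \<and> unswap s D \<in> M}"
        using C swap s ne inv by auto
      have "cover_monomial C = (var (om s) * cover_monomial (C - {om s}) :: ('v, 'k) mpol)"
        using C(3) cover_monomial_insert[of "om s" "C - {om s}"] by (simp add: insert_absorb)
      moreover have "cover_monomial (insert s (C - {om s})) =
          (var s * cover_monomial (C - {om s}) :: ('v, 'k) mpol)"
        using C(2) by (simp add: cover_monomial_insert)
      ultimately show "?h (insert s (C - {om s})) = cover_monomial C * (var s * g C)"
        unfolding inv by (simp add: mult_ac)
    next
      have ne: "om s \<noteq> s" using om_notin s by metis
      fix D assume D: "D \<in> {D \<in> M. s \<in> D \<and> om s \<notin> D \<and> unswap s D \<in> M}"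
      then show "insert s (unswap s D - {om s}) = D" "unswap s D \<in> {D \<in> M. s \<notin> D}"
        using ne by (auto simp: unswap_def)
    qed
    \<comment> \<open>Members that are not swaps can be added, since \<open>g\<close> vanishes
      outside \<open>M\<close>.\<close>
    also have "\<dots> = (\<Sum>D\<in>M. if s \<in> D \<and> om s \<notin> D then ?h D else 0)"
    proof (rule sum.mono_neutral_cong_left)
      show "\<forall>D\<in>M - {D \<in> M. s \<in> D \<and> om s \<notin> D \<and> unswap s D \<in> M}.
          (if s \<in> D \<and> om s \<notin> D then ?h D else 0) = 0"
      proof
        fix D assume "D \<in> M - {D \<in> M. s \<in> D \<and> om s \<notin> D \<and> unswap s D \<in> M}"
        moreover have "g (unswap s D) = 0" if "unswap s D \<notin> M" using g that by blast
        ultimately show "(if s \<in> D \<and> om s \<notin> D then ?h D else 0) = 0" by auto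
      qed
    qed auto
    finally have "(\<Sum>D\<in>M. cover_monomial D * (var s * g D)) - \<dots> = 0" by simp
    moreover have "cover_monomial D * edge_op s g D =
        cover_monomial D * (var s * g D) - (if s \<in> D \<and> om s \<notin> D then ?h D else 0)" for D
      by (cases "s \<in> D"; cases "om s \<in> D") (simp_all add: edge_op_def right_diff_distrib)
    ultimately show ?thesis by (simp add: sum_subtractf flip: g_def)
  qed
  then have "(\<Sum>s\<in>V'. ksgn s {} * (\<Sum>D\<in>M. cover_monomial D * edge_op s (\<lambda>D. f ({s}, D)) D)) = 0"
    by simp
  moreover have "aug (bd f) =
      (\<Sum>s\<in>V'. ksgn s {} * (\<Sum>D\<in>M. cover_monomial D * edge_op s (\<lambda>D. f ({s}, D)) D))"
    by (simp add: aug_def bd_def sum_distrib_left mult.left_commute) (rule sum.swap)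
  ultimately show ?thesis by simp
qed

text \<open>Undoing a swap enlarges \<open>V' - C\<close>, where \<open>f\<close> vanishes by
  \<open>top\<close>. Only the faces that keep the cover remain.\<close>

lemma bd_top_level:
  assumes f: "supported f" and C: "C \<in> M" "T \<subseteq> V' - C"
    and top: "\<And>T D. card (V' - C) < card (V' - D) \<Longrightarrow> f (T, D) = 0"
  shows "bd f (T, C) = koszul (V' - C) (\<lambda>T. f (T, C)) T"
proof -
  have "edge_op s (\<lambda>D. f (insert s T, D)) C = var s * f (insert s T, C)" if s: "s \<in> V'" for s
  proof -
    have "f (insert s T, unswap s C) = 0" if "s \<in> C" "om s \<notin> C"
    proof (rule top)
      have "V' - unswap s C = insert s (V' - C)"
        using s that om_notin[OF s] by (auto simp: unswap_def)
      then show "card (V' - C) < card (V' - unswap s C)" using that by simp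
    qed
    then show ?thesis by (simp add: edge_op_def)
  qed
  then have "bd f (T, C) = (\<Sum>s\<in>V' - T. ksgn s T * var s * f (insert s T, C))"
    by (simp add: bd_def mult.assoc)
  also have "\<dots> = (\<Sum>s\<in>V' - C - T. ksgn s T * var s * f (insert s T, C))"
    using f by (intro sum.mono_neutral_right) (auto simp: supported_def cells_def)
  finally show ?thesis by (simp add: koszul_def)
qed

text \<open>In the relation \<open>aug f = 0\<close>, every nonzero summand but that of
  \<open>C\<close> is divisible by a variable of \<open>V' - C\<close>. The monomial of
  \<open>C\<close> contains none of these variables and can be cancelled. This is the colon ideal
  computation behind linear quotients.\<close>

lemma aug_top_level:
  fixes f :: "'v set \<times> 'v set \<Rightarrow> ('v, 'k::field) mpol"
  assumes "aug f = 0" and C: "C \<in> M"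
    and top: "\<And>T D. card (V' - C) < card (V' - D) \<Longrightarrow> f (T, D) = 0"
  shows "f ({}, C) \<in> ideal_gen (var ` (V' - C))"
proof -
  have "cover_monomial D * f ({}, D) \<in> ideal_gen (var ` (V' - C))" if D: "D \<in> M - {C}" for D
  proof (cases "f ({}, D) = 0")
    case True
    then show ?thesis using ring.span_zero by simp
  next
    case False
    then obtain v where v: "v \<in> D" "v \<in> V' - C"
      using level_witness[OF C, of D] top[of D "{}"] D by force
    have "cover_monomial D * f ({}, D) = f ({}, D) * cover_monomial (D - {v}) * var v"
      using v(1) cover_monomial_insert[of v "D - {v}", where 'a = 'k]
      by (simp add: insert_absorb mult_ac)
    then show ?thesis using v(2) by (simp only:) (intro ring.span_scale ring.span_base imageI)
  qed
  then have "(\<Sum>D\<in>M - {C}. cover_monomial D * f ({}, D)) \<in> ideal_gen (var ` (V' - C))"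
    by (rule ring.span_sum)
  moreover have "cover_monomial C * f ({}, C) = - (\<Sum>D\<in>M - {C}. cover_monomial D * f ({}, D))"
    using assms(1) C by (simp add: aug_def sum.remove eq_neg_iff_add_eq_0)
  ultimately have "(\<Prod>v\<in>C. var v) * f ({}, C) \<in> ideal_gen (var ` (V' - C))"
    using ring.span_neg by (simp add: cover_monomial_def)
  then show ?thesis by (rule span_var_cancel_prod[rotated]) auto
qed

text \<open>The highest level of a cycle is a family of Koszul cycles, one for each cover of that
  level. Subtracting the boundary of their preimages pushes the cycle to lower levels.\<close>

lemma bd_exact_below:
  fixes f :: "'v set \<times> 'v set \<Rightarrow> ('v, 'k::field) mpol"
  assumes "supported f" "\<And>c. bd f c = 0" "aug f = 0"
    "\<And>T C. f (T, C) \<noteq> 0 \<Longrightarrow> card (V' - C) < k"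
  shows "\<exists>g. supported g \<and> (\<forall>c. f c = bd g c)"
  using assms
proof (induction k arbitrary: f)
  case 0
  then have "f c = 0" for c by (cases c) blast
  then show ?case
    by (intro exI[of _ "\<lambda>_. 0"]) (simp add: bd_zero supported_def)
next
  case (Suc k)
  have "\<exists>g. \<forall>T\<subseteq>V' - C. f (T, C) = koszul (V' - C) g T" if C: "C \<in> M" "card (V' - C) = k" for C
  proof (rule koszul_exact)
    have top: "f (T, D) = 0" if "card (V' - C) < card (V' - D)" for T D
      using Suc.prems(4)[of T D] that C(2) by force
    show "koszul (V' - C) (\<lambda>T. f (T, C)) T = 0" if "T \<subseteq> V' - C" for T
      using bd_top_level[OF Suc.prems(1) C(1) that top] Suc.prems(2) by simp
    show "f ({}, C) \<in> ideal_gen (var ` (V' - C))"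
      using aug_top_level[OF Suc.prems(3) C(1) top] .
  qed
  then obtain g where g: "\<And>C T. C \<in> M \<Longrightarrow> card (V' - C) = k \<Longrightarrow> T \<subseteq> V' - C \<Longrightarrow>
      f (T, C) = koszul (V' - C) (g C) T"
    by metis
  define h where "h c = (case c of (T, C) \<Rightarrow>
      if (T, C) \<in> cells \<and> card (V' - C) = k then g C T else 0)" for c
  have h: "supported h" by (auto simp: supported_def h_def)
  have htop: "h (T, D) = 0" if "card (V' - D) \<noteq> k" for T D using that by (simp add: h_def)
  \<comment> \<open>Above level \<open>k\<close> both \<open>f\<close> and \<open>bd h\<close>
    vanish, and on level \<open>k\<close> they agree. The swapped faces of \<open>h\<close> lie in
    lower levels and may remain.\<close>
  have level: "card (V' - C) < k" if ne: "f (T, C) - bd h (T, C) \<noteq> 0" for T C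
  proof (rule ccontr)
    assume ge: "\<not> ?thesis"
    have "(T, C) \<in> cells"
      using ne Suc.prems(1) supported_bd[OF h] unfolding supported_def by (metis diff_zero)
    then have C: "C \<in> M" "T \<subseteq> V' - C" by (auto simp: cells_def)
    have bdh: "bd h (T, C) = koszul (V' - C) (\<lambda>T. h (T, C)) T"
      using h C by (rule bd_top_level) (use ge htop in auto)
    show False
    proof (cases "card (V' - C) = k")
      case True
      have "koszul (V' - C) (\<lambda>T. h (T, C)) T = koszul (V' - C) (g C) T"
        using C True by (intro koszul_cong) (auto simp: h_def cells_def)
      then show False using g[OF C(1) True C(2)] bdh ne by simp
    next
      case False
      then have "f (T, C) = 0" using Suc.prems(4)[of T C] ge by force
      moreover have "bd h (T, C) = 0" unfolding bdh using htop[OF False] by (simp add: koszul_def)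
      ultimately show False using ne by simp
    qed
  qed
  have "\<exists>g. supported g \<and> (\<forall>c. f c - bd h c = bd g c)"
  proof (rule Suc.IH)
    show "supported (\<lambda>c. f c - bd h c)"
      using Suc.prems(1) supported_bd[OF h] by (simp add: supported_def)
    show "bd (\<lambda>c. f c - bd h c) c = 0" for c
      using Suc.prems(2) by (simp add: bd_diff bd_bd[OF h])
    show "aug (\<lambda>c. f c - bd h c) = 0" using Suc.prems(3) by (simp add: aug_diff aug_bd[OF h])
    show "f (T, C) - bd h (T, C) \<noteq> 0 \<Longrightarrow> card (V' - C) < k" for T C by (rule level)
  qed
  then obtain g' where g': "supported g'" "\<And>c. f c - bd h c = bd g' c" by blast
  \<comment> \<open>The sum of \<open>g'\<close> and \<open>h\<close>, written with differences so
    that \<open>bd_diff\<close> and \<open>bd_zero\<close> give additivity.\<close>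
  have "f c = bd (\<lambda>c. g' c - (0 - h c)) c" for c
    using g'(2)[of c] unfolding bd_diff bd_zero by (simp add: algebra_simps)
  moreover have "supported (\<lambda>c. g' c - (0 - h c))" using g'(1) h by (simp add: supported_def)
  ultimately show ?case by blast
qed

lemma bd_exact:
  assumes "supported f" "\<And>c. bd f c = 0" "aug f = 0"
  shows "\<exists>g. supported g \<and> (\<forall>c. f c = bd g c)"
  by (rule bd_exact_below[OF assms, of "Suc (card V')"]) (simp add: less_Suc_eq_le card_mono)

end

section \<open>Uniqueness of minimal graded free resolutions\<close>

text \<open>If \<open>r' < r\<close>, padding with zeros makes both matrices square. The one-sided
  inverse becomes two-sided, although the padded \<open>A\<close> has a zero row.\<close>

lemma left_inverse_imp_le:
  fixes A B :: "'k::field mat"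
  assumes A: "A \<in> carrier_mat r' r" and B: "B \<in> carrier_mat r r'" and BA: "B * A = 1\<^sub>m r"
  shows "r \<le> r'"
proof (rule ccontr)
  assume "\<not> r \<le> r'"
  then have lt: "r' < r" by simp
  define A' where "A' = mat r r (\<lambda>(a, b). if a < r' then A $$ (a, b) else 0)"
  define B' where "B' = mat r r (\<lambda>(a, b). if b < r' then B $$ (a, b) else 0)"
  have carr: "A' \<in> carrier_mat r r" "B' \<in> carrier_mat r r" by (simp_all add: A'_def B'_def)
  have "B' * A' = B * A"
  proof (rule eq_matI)
    fix i j assume "i < dim_row (B * A)" "j < dim_col (B * A)"
    then have ij: "i < r" "j < r" using A B by auto
    have "(B' * A') $$ (i, j) =
        (\<Sum>c\<in>{0..<r}. if c < r' then B $$ (i, c) * A $$ (c, j) else 0)"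
      using ij by (simp add: A'_def B'_def scalar_prod_def) (intro sum.cong, auto)
    also have "\<dots> = (\<Sum>c\<in>{0..<r'}. B $$ (i, c) * A $$ (c, j))"
      using lt by (intro sum.mono_neutral_cong_right) auto
    also have "\<dots> = (B * A) $$ (i, j)" using ij A B by (simp add: scalar_prod_def)
    finally show "(B' * A') $$ (i, j) = (B * A) $$ (i, j)" .
  qed (use A B in \<open>simp_all add: A'_def B'_def\<close>)
  then have "A' * B' = 1\<^sub>m r" using mat_mult_left_right_inverse[OF carr(2,1)] BA by simp
  then have "(A' * B') $$ (r', r') = 1" using lt by simp
  moreover have "(A' * B') $$ (r', r') = 0"
    using lt by (simp add: A'_def B'_def scalar_prod_def)
  ultimately show False by simp
qed

text \<open>Some summand in the Leibniz expansion of a nonzero determinant is nonzero. The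
  permutation will pair basis elements of equal degree.\<close>

lemma invertible_imp_nonzero_permutation:
  fixes A B :: "'k::field mat"
  assumes A: "A \<in> carrier_mat r r" and B: "B \<in> carrier_mat r r" and BA: "B * A = 1\<^sub>m r"
  shows "\<exists>p. p permutes {0..<r} \<and> (\<forall>i<r. A $$ (i, p i) \<noteq> 0)"
proof -
  have "det B * det A = 1" using det_mult[OF B A] BA by simp
  then have "(\<Sum>p\<in>{p. p permutes {0..<r}}. signof p * (\<Prod>i = 0..<r. A $$ (i, p i))) \<noteq> 0"
    using det_def'[OF A] by auto
  then obtain p where p: "p permutes {0..<r}" "(\<Prod>i = 0..<r. A $$ (i, p i)) \<noteq> 0"
    by (metis (no_types, lifting) mem_Collect_eq mult_zero_right sum.neutral)
  then show ?thesis by (intro exI[of _ p]) simp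
qed

text \<open>For free modules the conditions can be tested on unit vectors. As matrix identities they
  are accessible to homogeneous components, entry by entry.\<close>

lemma chain_map_free_iff:
  fixes eps eps' :: "'r::comm_ring_1 vec"
  assumes R: "projective_resolution J r (\<lambda>i. carrier_vec (r i)) eps D"
    and R': "projective_resolution J r' (\<lambda>i. carrier_vec (r' i)) eps' D'"
  shows "chain_map r (\<lambda>i. carrier_vec (r i)) eps D r' (\<lambda>i. carrier_vec (r' i)) eps' D' F \<longleftrightarrow>
     (\<forall>i. F i \<in> carrier_mat (r' i) (r i)) \<and> (\<forall>b<r 0. eps' \<bullet> col (F 0) b = eps $ b) \<and>
     (\<forall>i. D' i * F (Suc i) = F i * D i)"
proof (cases "\<forall>i. F i \<in> carrier_mat (r' i) (r i)")
  case False
  then show ?thesis unfolding chain_map_def by blast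
next
  case True
  then have F: "F i \<in> carrier_mat (r' i) (r i)" for i by simp
  note RD = projective_resolutionD[OF R] and RD' = projective_resolutionD[OF R']
  have "(\<forall>v\<in>carrier_vec (r 0). eps' \<bullet> (F 0 *\<^sub>v v) = eps \<bullet> v) \<longleftrightarrow>
      (\<forall>b<r 0. eps' \<bullet> col (F 0) b = eps $ b)" (is "?L \<longleftrightarrow> ?R")
  proof
    assume L: ?L
    show ?R
    proof (intro allI impI)
      fix b assume b: "b < r 0"
      have "F 0 *\<^sub>v unit_vec (r 0) b = col (F 0) b"
        using F[of 0] b by (intro eq_vecI) (auto simp: scalar_prod_right_unit[where n = "r 0"])
      then show "eps' \<bullet> col (F 0) b = eps $ b"
        using L[rule_format, of "unit_vec (r 0) b"] scalar_prod_right_unit[OF b] by simp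
    qed
  next
    assume R: ?R
    show ?L
    proof
      fix v :: "'r vec" assume v: "v \<in> carrier_vec (r 0)"
      have "(F 0)\<^sup>T *\<^sub>v eps' = eps"
        using F[of 0] R RD(2) RD'(2)
        by (intro eq_vecI) (auto simp: comm_scalar_prod[of "col (F 0) _" "r' 0" eps'])
      then show "eps' \<bullet> (F 0 *\<^sub>v v) = eps \<bullet> v"
        using transpose_vec_mult_scalar[OF F[of 0] v RD'(2)] by simp
    qed
  qed
  moreover have "(\<forall>v\<in>carrier_vec (r (Suc i)). D' i *\<^sub>v (F (Suc i) *\<^sub>v v) = F i *\<^sub>v (D i *\<^sub>v v)) \<longleftrightarrow>
      D' i * F (Suc i) = F i * D i" (is "?L \<longleftrightarrow> ?R") for i
  proof -
    have "?L \<longleftrightarrow> (\<forall>v\<in>carrier_vec (r (Suc i)). D' i * F (Suc i) *\<^sub>v v = F i * D i *\<^sub>v v)"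
      using assoc_mult_mat_vec[OF RD'(3) F] assoc_mult_mat_vec[OF F RD(3)] by simp
    also have "\<dots> \<longleftrightarrow> ?R"
      using eq_mat_by_vec[OF mult_carrier_mat[OF RD'(3) F] mult_carrier_mat[OF F RD(3)], of i] by auto
    finally show ?thesis .
  qed
  moreover have "\<forall>i. \<forall>v\<in>carrier_vec (r i). F i *\<^sub>v v \<in> carrier_vec (r' i)"
    using F mult_mat_vec_carrier by blast
  ultimately show ?thesis using True unfolding chain_map_def by simp
qed

lemma minimal_graded_free_resolutionD:
  assumes "minimal_graded_free_resolution J r d eps D"
  shows "projective_resolution J r (\<lambda>i. carrier_vec (r i)) eps D"
    and "a < r 0 \<Longrightarrow> ihom (int (d 0 a)) (eps $ a)"
    and "a < r i \<Longrightarrow> b < r (Suc i) \<Longrightarrow> ihom (int (d (Suc i) b) - int (d i a)) (D i $$ (a, b))"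
    and "a < r i \<Longrightarrow> b < r (Suc i) \<Longrightarrow> const_coeff (D i $$ (a, b)) = 0"
proof -
  note * = assms[unfolded minimal_graded_free_resolution_def]
  show "projective_resolution J r (\<lambda>i. carrier_vec (r i)) eps D"
    by (rule *[THEN conjunct1])
  show "ihom (int (d 0 a)) (eps $ a)" if "a < r 0"
    using *[THEN conjunct2, THEN conjunct1] that by (simp add: ihom_of_nat)
  assume ab: "a < r i" "b < r (Suc i)"
  note ** = *[THEN conjunct2, THEN conjunct2, rule_format, OF ab]
  show "const_coeff (D i $$ (a, b)) = 0" using ** by (intro const_coeff_irrelevant) simp
  show "ihom (int (d (Suc i) b) - int (d i a)) (D i $$ (a, b))"
  proof (cases "d i a \<le> d (Suc i) b")
    case True
    then have "ihom (int (d (Suc i) b - d i a)) (D i $$ (a, b))"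
      using ** unfolding ihom_of_nat by simp
    then show ?thesis using True by (simp add: of_nat_diff)
  next
    case False
    then have "D i $$ (a, b) = 0" using ** by simp
    then show ?thesis by simp
  qed
qed

text \<open>Every entry of an arbitrary chain map is replaced by its component in the degree that a
  graded map has there. The differentials are homogeneous, so both sides of each commutation
  identity are cut down to the same degree.\<close>

lemma graded_chain_map_exists:
  fixes J :: "('v::finite, 'k::field) mpol set"
  assumes M: "minimal_graded_free_resolution J r d eps D"
    and M': "minimal_graded_free_resolution J r' d' eps' D'"
  shows "\<exists>F. chain_map r (\<lambda>i. carrier_vec (r i)) eps D r' (\<lambda>i. carrier_vec (r' i)) eps' D' F \<and>
    (\<forall>i. \<forall>a<r' i. \<forall>b<r i. ihom (int (d i b) - int (d' i a)) (F i $$ (a, b)))"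
proof -
  note MD = minimal_graded_free_resolutionD[OF M] and MD' = minimal_graded_free_resolutionD[OF M']
  note RD = projective_resolutionD[OF MD(1)] and RD' = projective_resolutionD[OF MD'(1)]
  obtain F where "chain_map r (\<lambda>i. carrier_vec (r i)) eps D r' (\<lambda>i. carrier_vec (r' i)) eps' D' F"
    using chain_map_exists[OF MD(1) MD'(1)] .
  then have F: "\<And>i. F i \<in> carrier_mat (r' i) (r i)"
    "\<And>b. b < r 0 \<Longrightarrow> eps' \<bullet> col (F 0) b = eps $ b" "\<And>i. D' i * F (Suc i) = F i * D i"
    unfolding chain_map_free_iff[OF MD(1) MD'(1)] by blast+
  define G where "G i = mat (r' i) (r i) (\<lambda>(a, b). hcomp (int (d i b) - int (d' i a)) (F i $$ (a, b)))" for i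
  have G: "G i \<in> carrier_mat (r' i) (r i)" for i by (simp add: G_def)
  have "eps' \<bullet> col (G 0) b = eps $ b" if b: "b < r 0" for b
  proof -
    have "eps' \<bullet> col (G 0) b =
        (\<Sum>c\<in>{0..<r' 0}. eps' $ c * hcomp (int (d 0 b) - int (d' 0 c)) (F 0 $$ (c, b)))"
      using b by (simp add: scalar_prod_def G_def)
    also have "\<dots> = (\<Sum>c\<in>{0..<r' 0}. hcomp (int (d 0 b)) (eps' $ c * F 0 $$ (c, b)))"
    proof (rule sum.cong)
      fix c assume "c \<in> {0..<r' 0}"
      then show "eps' $ c * hcomp (int (d 0 b) - int (d' 0 c)) (F 0 $$ (c, b)) =
          hcomp (int (d 0 b)) (eps' $ c * F 0 $$ (c, b))"
        using hcomp_mult[OF MD'(2)[of c], of "int (d 0 b) - int (d' 0 c)"] by simp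
    qed simp
    also have "\<dots> = hcomp (int (d 0 b)) (eps' \<bullet> col (F 0) b)"
      using b F(1)[of 0] by (simp add: scalar_prod_def hcomp_sum)
    also have "\<dots> = eps $ b" using F(2)[OF b] hcomp_ihom[OF MD(2)[OF b]] by simp
    finally show ?thesis .
  qed
  moreover have "D' i * G (Suc i) = G i * D i" for i
  proof (rule eq_matI)
    fix a b assume "a < dim_row (G i * D i)" "b < dim_col (G i * D i)"
    then have ab: "a < r' i" "b < r (Suc i)" using G[of i] RD(3)[of i] by simp_all
    let ?e = "int (d (Suc i) b) - int (d' i a)"
    note c = G[of i] G[of "Suc i"] F(1)[of i] F(1)[of "Suc i"] RD(3)[of i] RD'(3)[of i]
    have "(D' i * G (Suc i)) $$ (a, b) = (\<Sum>k\<in>{0..<r' (Suc i)}.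
        D' i $$ (a, k) * hcomp (int (d (Suc i) b) - int (d' (Suc i) k)) (F (Suc i) $$ (k, b)))"
      using ab c by (simp add: scalar_prod_def) (simp add: G_def)
    also have "\<dots> = (\<Sum>k\<in>{0..<r' (Suc i)}. hcomp ?e (D' i $$ (a, k) * F (Suc i) $$ (k, b)))"
    proof (rule sum.cong)
      fix k assume "k \<in> {0..<r' (Suc i)}"
      then show "D' i $$ (a, k) * hcomp (int (d (Suc i) b) - int (d' (Suc i) k)) (F (Suc i) $$ (k, b)) =
          hcomp ?e (D' i $$ (a, k) * F (Suc i) $$ (k, b))"
        using hcomp_mult[OF MD'(3)[OF ab(1), of k], of "int (d (Suc i) b) - int (d' (Suc i) k)"] by simp
    qed simp
    also have "\<dots> = hcomp ?e ((D' i * F (Suc i)) $$ (a, b))"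
      using ab c by (simp add: scalar_prod_def hcomp_sum)
    also have "\<dots> = hcomp ?e ((F i * D i) $$ (a, b))" by (simp only: F(3))
    also have "\<dots> = (\<Sum>k\<in>{0..<r i}. hcomp ?e (D i $$ (k, b) * F i $$ (a, k)))"
      using ab c by (simp add: scalar_prod_def hcomp_sum mult.commute)
    also have "\<dots> = (\<Sum>k\<in>{0..<r i}. D i $$ (k, b) * hcomp (int (d i k) - int (d' i a)) (F i $$ (a, k)))"
    proof (rule sum.cong)
      fix k assume "k \<in> {0..<r i}"
      then show "hcomp ?e (D i $$ (k, b) * F i $$ (a, k)) =
          D i $$ (k, b) * hcomp (int (d i k) - int (d' i a)) (F i $$ (a, k))"
        using hcomp_mult[OF MD(3)[of k i, OF _ ab(2)], of "int (d i k) - int (d' i a)"] by simp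
    qed simp
    also have "\<dots> = (G i * D i) $$ (a, b)"
      using ab c by (simp add: scalar_prod_def) (simp add: G_def mult.commute)
    finally show "(D' i * G (Suc i)) $$ (a, b) = (G i * D i) $$ (a, b)" .
  qed (use G[of i] G[of "Suc i"] RD(3)[of i] RD'(3)[of i] in auto)
  ultimately have "chain_map r (\<lambda>i. carrier_vec (r i)) eps D r' (\<lambda>i. carrier_vec (r' i)) eps' D' G"
    unfolding chain_map_free_iff[OF MD(1) MD'(1)] using G by blast
  moreover have "ihom (int (d i b) - int (d' i a)) (G i $$ (a, b))" if "a < r' i" "b < r i" for i a b
    using that by (simp add: G_def ihom_hcomp)
  ultimately show ?thesis by blast
qed

lemma map_const_coeff_mult:
  fixes G F :: "('v, 'k::comm_ring_1) mpol mat"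
  assumes "G \<in> carrier_mat a b" "F \<in> carrier_mat b c"
  shows "map_mat const_coeff G * map_mat const_coeff F = map_mat const_coeff (G * F)"
  using assms by (intro eq_matI) (auto simp: scalar_prod_def const_coeff_sum const_coeff_mult)

text \<open>\<open>A\<close> and \<open>B\<close> are chain maps reduced modulo the variables. Only
  \<open>F\<close> is taken graded, because degrees are read off from \<open>A\<close> alone: a
  nonzero constant term forces degree zero.\<close>

lemma minimal_resolution_comparison:
  fixes J :: "('v::finite, 'k::field) mpol set"
  assumes M: "minimal_graded_free_resolution J r d eps D"
    and M': "minimal_graded_free_resolution J r' d' eps' D'"
  shows "\<exists>A B. A \<in> carrier_mat (r' i) (r i) \<and> B \<in> carrier_mat (r i) (r' i) \<and> B * A = 1\<^sub>m (r i) \<and>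
    (\<forall>a<r' i. \<forall>b<r i. A $$ (a, b) \<noteq> (0 :: 'k) \<longrightarrow> d' i a = d i b)"
proof -
  note MD = minimal_graded_free_resolutionD[OF M] and MD' = minimal_graded_free_resolutionD[OF M']
  obtain F where F: "chain_map r (\<lambda>i. carrier_vec (r i)) eps D r' (\<lambda>i. carrier_vec (r' i)) eps' D' F"
    "\<forall>i. \<forall>a<r' i. \<forall>b<r i. ihom (int (d i b) - int (d' i a)) (F i $$ (a, b))"
    using graded_chain_map_exists[OF M M'] by blast
  obtain G where G: "chain_map r' (\<lambda>i. carrier_vec (r' i)) eps' D' r (\<lambda>i. carrier_vec (r i)) eps D G"
    using chain_map_exists[OF MD'(1) MD(1)] .
  have carr: "F i \<in> carrier_mat (r' i) (r i)" "G i \<in> carrier_mat (r i) (r' i)"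
    using F(1) G by (simp_all add: chain_map_def)
  have "const_coeff ((G i * F i) $$ (a, b)) = (if a = b then 1 else 0)" if "a < r i" "b < r i" for a b
    by (rule minimal_chain_self_map[OF MD(1,4) chain_map_comp[OF F(1) G MD(1)] that])
  then have "map_mat const_coeff (G i) * map_mat const_coeff (F i) = 1\<^sub>m (r i)"
    unfolding map_const_coeff_mult[OF carr(2,1)] using carr by (intro eq_matI) auto
  moreover have "d' i a = d i b" if ab: "a < r' i" "b < r i" and "map_mat const_coeff (F i) $$ (a, b) \<noteq> 0" for a b
  proof -
    have "0 \<in> Poly_Mapping.keys (F i $$ (a, b))"
      using that carr(1) by (simp add: const_coeff_def in_keys_iff)
    then have "int (mdeg (0 :: 'v \<Rightarrow>\<^sub>0 nat)) = int (d i b) - int (d' i a)"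
      using F(2) ab unfolding ihom_def by blast
    then show ?thesis by (simp add: mdeg_def)
  qed
  ultimately show ?thesis using carr
    by (intro exI[of _ "map_mat const_coeff (F i)"] exI[of _ "map_mat const_coeff (G i)"]) auto
qed

text \<open>Left inverses in both directions equate the ranks. The reduced comparison is then
  invertible and links only basis elements of equal degree, so a permutation along nonzero entries
  matches them.\<close>

lemma minimal_resolution_unique:
  fixes J :: "('v::finite, 'k::field) mpol set"
  assumes M: "minimal_graded_free_resolution J r d eps D"
    and M': "minimal_graded_free_resolution J r' d' eps' D'"
  shows "r' i = r i" and "card {a. a < r' i \<and> d' i a = j} = card {a. a < r i \<and> d i a = j}"
proof -
  obtain A B where AB: "A \<in> carrier_mat (r' i) (r i)" "B \<in> carrier_mat (r i) (r' i)" "B * A = 1\<^sub>m (r i)"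
    "\<forall>a<r' i. \<forall>b<r i. A $$ (a, b) \<noteq> (0 :: 'k) \<longrightarrow> d' i a = d i b"
    using minimal_resolution_comparison[OF M M', of i] by blast
  have "r' i \<le> r i"
    using minimal_resolution_comparison[OF M' M, of i] left_inverse_imp_le by blast
  then show r: "r' i = r i" using left_inverse_imp_le[OF AB(1-3)] by simp
  obtain p where p: "p permutes {0..<r i}" "\<forall>a<r i. A $$ (a, p a) \<noteq> 0"
    using invertible_imp_nonzero_permutation[of A "r i" B] AB(1-3) r by auto
  have lt: "p a < r i \<longleftrightarrow> a < r i" for a using permutes_in_image[OF p(1), of a] by simp
  then have deg: "d' i a = d i (p a)" if "a < r i" for a using AB(4) p(2) r that by simp
  have "bij_betw p {a. a < r' i \<and> d' i a = j} {a. a < r i \<and> d i a = j}"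
    unfolding bij_betw_def
  proof
    show "inj_on p {a. a < r' i \<and> d' i a = j}" using permutes_inj[OF p(1)] by (rule inj_on_subset) simp
    show "p ` {a. a < r' i \<and> d' i a = j} = {a. a < r i \<and> d i a = j}"
    proof (intro equalityI subsetI)
      fix b assume b: "b \<in> {a. a < r i \<and> d i a = j}"
      obtain a where a: "b = p a" using permutes_surj[OF p(1)] by blast
      then show "b \<in> p ` {a. a < r' i \<and> d' i a = j}" using b lt[of a] deg[of a] r by auto
    qed (use lt deg r in auto)
  qed
  then show "card {a. a < r' i \<and> d' i a = j} = card {a. a < r i \<and> d i a = j}"
    by (rule bij_betw_same_card)
qed

lemma betti_eq_rank:
  fixes J :: "('v::finite, 'k::field) mpol set"
  assumes "minimal_graded_free_resolution J r d eps D"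
  shows "betti i J = r i"
  unfolding betti_def
proof (rule the_equality)
  show "\<exists>r' d eps D. minimal_graded_free_resolution J r' d eps D \<and> r i = r' i" using assms by blast
qed (use minimal_resolution_unique(1)[OF assms] in blast)

lemma graded_betti_eq_card:
  fixes J :: "('v::finite, 'k::field) mpol set"
  assumes "minimal_graded_free_resolution J r d eps D"
  shows "graded_betti i j J = card {a. a < r i \<and> d i a = j}"
  unfolding graded_betti_def
proof (rule the_equality)
  show "\<exists>r' d' eps D. minimal_graded_free_resolution J r' d' eps D \<and>
      card {a. a < r i \<and> d i a = j} = card {a. a < r' i \<and> d' i a = j}" using assms by blast
qed (use minimal_resolution_unique(2)[OF assms] in blast)

text \<open>Otherwise the composite of the comparison maps, which is the identity modulo the
  variables, would factor through zero in degree \<open>N\<close>.\<close>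

lemma projective_module_nonzero:
  fixes J :: "('v::finite, 'k::field) mpol set"
  assumes M: "minimal_graded_free_resolution J r d eps D"
    and R': "projective_resolution J r' P' eps' D'" and zero: "P' N = {0\<^sub>v (r' N)}"
  shows "r N = 0"
proof (rule ccontr)
  assume "r N \<noteq> 0"
  then have N: "0 < r N" by simp
  note MD = minimal_graded_free_resolutionD[OF M]
  obtain F where F: "chain_map r (\<lambda>i. carrier_vec (r i)) eps D r' P' eps' D' F"
    using chain_map_exists[OF MD(1) R'] .
  obtain G where G: "chain_map r' P' eps' D' r (\<lambda>i. carrier_vec (r i)) eps D G"
    using chain_map_exists[OF R' MD(1)] .
  let ?u = "unit_vec (r N) 0 :: ('v, 'k) mpol vec"
  have carr: "F N \<in> carrier_mat (r' N) (r N)" "G N \<in> carrier_mat (r N) (r' N)"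
    using F G by (simp_all add: chain_map_def)
  have "F N *\<^sub>v ?u \<in> P' N" using F unfolding chain_map_def by simp
  then have "F N *\<^sub>v ?u = 0\<^sub>v (r' N)" using zero by simp
  moreover have "G N *\<^sub>v 0\<^sub>v (r' N) = 0\<^sub>v (r N)" using carr by (intro eq_vecI) auto
  ultimately have "G N * F N *\<^sub>v ?u = 0\<^sub>v (r N)"
    using assoc_mult_mat_vec[OF carr(2,1), of ?u] by simp
  moreover have "(G N * F N *\<^sub>v ?u) $ 0 = row (G N * F N) 0 \<bullet> ?u"
    using carr N by (intro index_mult_mat_vec) simp
  moreover have "row (G N * F N) 0 \<bullet> ?u = row (G N * F N) 0 $ 0"
    using carr N by (intro scalar_prod_right_unit) auto
  moreover have "row (G N * F N) 0 $ 0 = (G N * F N) $$ (0, 0)" using carr N by (intro index_row) auto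
  ultimately have "(G N * F N) $$ (0, 0) = 0" using N by simp
  moreover have "const_coeff ((G N * F N) $$ (0, 0)) = 1"
    using minimal_chain_self_map[OF MD(1,4) chain_map_comp[OF F G MD(1)] N N] by simp
  ultimately show False by simp
qed

lemma projective_dimension_eq:
  fixes J :: "('v::finite, 'k::field) mpol set"
  assumes M: "minimal_graded_free_resolution J r d eps D"
    and N: "r N \<noteq> 0" "\<And>i. N < i \<Longrightarrow> r i = 0"
  shows "projective_dimension J = enat N"
  unfolding projective_dimension_def
proof (rule antisym)
  have "carrier_vec (r i) = {0\<^sub>v (r i) :: ('v, 'k) mpol vec}" if "N < i" for i
    using N(2)[OF that] by auto
  then show "Inf {enat n | n. \<exists>r P eps D. projective_resolution J r P eps D \<and> (\<forall>i>n. P i = {0\<^sub>v (r i)})} \<le> enat N"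
    using minimal_graded_free_resolutionD(1)[OF M] by (intro Inf_lower) blast
  show "enat N \<le> Inf {enat n | n. \<exists>r P eps D. projective_resolution J r P eps D \<and> (\<forall>i>n. P i = {0\<^sub>v (r i)})}"
  proof (rule Inf_greatest)
    fix e assume "e \<in> {enat n | n. \<exists>r P eps D. projective_resolution J r P eps D \<and> (\<forall>i>n. P i = {0\<^sub>v (r i)})}"
    then obtain n r' P' eps' D' where n: "e = enat n" "projective_resolution J r' P' eps' D'"
      "\<forall>i>n. P' i = {0\<^sub>v (r' i)}" by blast
    have "\<not> n < N" using projective_module_nonzero[OF M n(2), of N] n(3) N(1) by blast
    then show "enat N \<le> e" using n(1) by simp
  qed
qed

section \<open>The resolution of the ideal of a swap family\<close>

context swap_family
begin

definition cells_of :: "nat \<Rightarrow> ('v set \<times> 'v set) set" where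
  "cells_of i = {c \<in> cells. card (fst c) = i}"

definition rank :: "nat \<Rightarrow> nat" where
  "rank i = card (cells_of i)"

text \<open>Any numbering of the cells gives an ordered basis, so an arbitrary bijection is
  chosen.\<close>

definition enum :: "nat \<Rightarrow> nat \<Rightarrow> 'v set \<times> 'v set" where
  "enum i = (SOME e. bij_betw e {0..<rank i} (cells_of i))"

definition supported_in :: "nat \<Rightarrow> ('v set \<times> 'v set \<Rightarrow> ('v, 'k::field) mpol) \<Rightarrow> bool" where
  "supported_in i f \<longleftrightarrow> (\<forall>c. c \<notin> cells_of i \<longrightarrow> f c = 0)"

definition to_vec :: "nat \<Rightarrow> ('v set \<times> 'v set \<Rightarrow> ('v, 'k::field) mpol) \<Rightarrow> ('v, 'k) mpol vec" where
  "to_vec i f = vec (rank i) (\<lambda>a. f (enum i a))"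

definition cell_fun :: "'v set \<times> 'v set \<Rightarrow> 'v set \<times> 'v set \<Rightarrow> ('v, 'k::field) mpol" where
  "cell_fun c = (\<lambda>c'. if c' = c then 1 else 0)"

definition bd_mat :: "nat \<Rightarrow> ('v, 'k::field) mpol mat" where
  "bd_mat i = mat (rank i) (rank (Suc i)) (\<lambda>(a, b). bd (cell_fun (enum (Suc i) b)) (enum i a))"

definition aug_vec :: "('v, 'k::field) mpol vec" where
  "aug_vec = vec (rank 0) (\<lambda>a. cover_monomial (snd (enum 0 a)))"

section \<open>Chains as coordinate vectors\<close>

lemma enum_bij: "bij_betw (enum i) {0..<rank i} (cells_of i)"
proof -
  have "\<exists>e. bij_betw e {0..<rank i} (cells_of i)"
    unfolding rank_def by (rule ex_bij_betw_nat_finite) simp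
  then show ?thesis unfolding enum_def by (rule someI_ex)
qed

lemma enum_in: "a < rank i \<Longrightarrow> enum i a \<in> cells_of i"
  using bij_betw_apply[OF enum_bij, of a i] by simp

lemma sum_enum: "(\<Sum>a\<in>{0..<rank i}. f (enum i a)) = sum f (cells_of i)"
  by (rule sum.reindex_bij_betw[OF enum_bij])

lemma supported_inD: "supported_in i f \<Longrightarrow> c \<notin> cells_of i \<Longrightarrow> f c = 0"
  unfolding supported_in_def by blast

lemma to_vec_carrier [simp]: "to_vec i f \<in> carrier_vec (rank i)"
  by (simp add: to_vec_def)

lemma to_vec_eq_iff:
  assumes "supported_in i f" "supported_in i g"
  shows "to_vec i f = to_vec i g \<longleftrightarrow> f = g"
proof
  assume eq: "to_vec i f = to_vec i g"
  show "f = g"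
  proof
    fix c
    show "f c = g c"
    proof (cases "c \<in> cells_of i")
      case True
      then have "c \<in> enum i ` {0..<rank i}" unfolding bij_betw_imp_surj_on[OF enum_bij] .
      then obtain a where a: "c = enum i a" "a \<in> {0..<rank i}" by (rule imageE)
      then show ?thesis using arg_cong[OF eq, of "\<lambda>v. v $ a"] by (simp add: to_vec_def)
    next
      case False
      then show ?thesis using assms by (simp add: supported_inD)
    qed
  qed
qed simp

lemma carrier_vec_eq_to_vec:
  "carrier_vec (rank i) = to_vec i ` {f :: _ \<Rightarrow> ('v, 'k::field) mpol. supported_in i f}"
proof (intro equalityI subsetI)
  fix v :: "('v, 'k) mpol vec" assume v: "v \<in> carrier_vec (rank i)"
  define f where "f c = (if c \<in> cells_of i then v $ the_inv_into {0..<rank i} (enum i) c else 0)" for c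
  have "the_inv_into {0..<rank i} (enum i) (enum i a) = a" if "a < rank i" for a
    using that by (intro the_inv_into_f_f[OF bij_betw_imp_inj_on[OF enum_bij]]) simp
  then have "v = to_vec i f" using v by (intro eq_vecI) (auto simp: to_vec_def f_def enum_in)
  moreover have "supported_in i f" by (simp add: supported_in_def f_def)
  ultimately show "v \<in> to_vec i ` {f. supported_in i f}" by blast
qed auto

lemma to_vec_zero: "to_vec i (\<lambda>_. 0) = 0\<^sub>v (rank i)"
  by (auto simp: to_vec_def)

lemma supported_in_zero: "supported_in i (\<lambda>_. 0)"
  by (simp add: supported_in_def)

lemma supported_in_imp: "supported_in i f \<Longrightarrow> supported f"
  by (auto simp: supported_in_def supported_def cells_of_def)

text \<open>The boundary at \<open>T\<close> reads \<open>f\<close> only on sets with one element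
  more.\<close>

lemma bd_support:
  assumes "supported_in i f" "\<And>s. s \<in> V' - T \<Longrightarrow> Suc (card T) \<noteq> i"
  shows "bd f (T, D) = 0"
proof -
  have "edge_op s (\<lambda>D. f (insert s T, D)) D = 0" if s: "s \<in> V' - T" for s
  proof -
    have "card (insert s T) \<noteq> i" using assms(2)[OF s] s by simp
    then have "f (insert s T, C) = 0" for C using assms(1) by (simp add: supported_in_def cells_of_def)
    then show ?thesis by (simp add: edge_op_def)
  qed
  then show ?thesis by (simp add: bd_def)
qed

lemma supported_in_bd:
  assumes "supported_in (Suc i) f"
  shows "supported_in i (bd f)"
  unfolding supported_in_def
proof (intro allI impI)
  fix c assume c: "c \<notin> cells_of i"
  obtain T D where TD: "c = (T, D)" by (cases c)
  show "bd f c = 0"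
  proof (cases "c \<in> cells")
    case True
    then have "card T \<noteq> i" using c by (simp add: cells_of_def TD)
    then show ?thesis unfolding TD using assms by (intro bd_support[of "Suc i"]) simp_all
  next
    case False
    then show ?thesis using supported_bd[OF supported_in_imp[OF assms]] unfolding supported_def by blast
  qed
qed

text \<open>Exactness yields a preimage \<open>g\<close> of mixed dimension. Its part of dimension
  \<open>Suc i\<close> suffices, since the boundary lowers the dimension by exactly one.\<close>

lemma bd_cycle_exact:
  fixes f g :: "'v set \<times> 'v set \<Rightarrow> ('v, 'k::field) mpol"
  assumes f: "supported_in i f" and g: "f = bd g" "supported g"
  shows "\<exists>h. supported_in (Suc i) h \<and> f = bd h"
proof (intro exI conjI)
  define h :: "'v set \<times> 'v set \<Rightarrow> ('v, 'k) mpol" where "h c = (if card (fst c) = Suc i then g c else 0)" for c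
  show h: "supported_in (Suc i) h"
    using g(2) by (auto simp: supported_in_def supported_def cells_of_def h_def)
  show "f = bd h"
  proof
    fix c :: "'v set \<times> 'v set"
    obtain T D where TD: "c = (T, D)" by (cases c)
    show "f c = bd h c"
    proof (cases "card T = i")
      case True
      have "f c = bd g c" using g(1) by simp
      also have "\<dots> = bd h c"
        unfolding TD bd_def prod.case
      proof (rule sum.cong)
        fix s assume "s \<in> V' - T"
        then have "h (insert s T, C) = g (insert s T, C)" for C using True by (simp add: h_def)
        then show "ksgn s T * edge_op s (\<lambda>D. g (insert s T, D)) D =
            ksgn s T * edge_op s (\<lambda>D. h (insert s T, D)) D" by simp
      qed simp
      finally show ?thesis .
    next
      case False
      then have "f c = 0" using f by (simp add: TD supported_in_def cells_of_def)
      moreover have "bd h c = 0" unfolding TD using h False by (intro bd_support[of "Suc i"]) simp_all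
      ultimately show ?thesis by simp
    qed
  qed
qed

lemma bd_mat_carrier [simp]: "bd_mat i \<in> carrier_mat (rank i) (rank (Suc i))"
  by (simp add: bd_mat_def)

lemma bd_mat_mult:
  fixes f :: "'v set \<times> 'v set \<Rightarrow> ('v, 'k::field) mpol"
  assumes "supported_in (Suc i) f"
  shows "bd_mat i *\<^sub>v to_vec (Suc i) f = to_vec i (bd f)"
proof (rule eq_vecI)
  fix a assume "a < dim_vec (to_vec i (bd f))"
  then have a: "a < rank i" by (simp add: to_vec_def)
  \<comment> \<open>\<open>f\<close> is expanded in the basis of cells, so that linearity of
    \<open>bd\<close> produces the columns of the matrix.\<close>
  have f: "(\<lambda>c. \<Sum>b\<in>{0..<rank (Suc i)}. f (enum (Suc i) b) * cell_fun (enum (Suc i) b) c) = f"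
  proof
    fix c
    have "(\<Sum>b\<in>{0..<rank (Suc i)}. f (enum (Suc i) b) * cell_fun (enum (Suc i) b) c) =
        (\<Sum>c'\<in>cells_of (Suc i). f c' * cell_fun c' c)"
      by (rule sum_enum[where f = "\<lambda>c'. f c' * cell_fun c' c"])
    also have "\<dots> = (\<Sum>c'\<in>cells_of (Suc i). if c' = c then f c' else 0)"
      by (intro sum.cong) (auto simp: cell_fun_def)
    also have "\<dots> = f c" using supported_inD[OF assms] by simp
    finally show "(\<Sum>b\<in>{0..<rank (Suc i)}. f (enum (Suc i) b) * cell_fun (enum (Suc i) b) c) = f c" .
  qed
  have "(bd_mat i *\<^sub>v to_vec (Suc i) f) $ a =
      (\<Sum>b\<in>{0..<rank (Suc i)}. f (enum (Suc i) b) * bd (cell_fun (enum (Suc i) b)) (enum i a))"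
    using a by (simp add: bd_mat_def to_vec_def scalar_prod_def mult.commute)
  also have "\<dots> = bd f (enum i a)"
    unfolding bd_sum[symmetric] f ..
  finally show "(bd_mat i *\<^sub>v to_vec (Suc i) f) $ a = to_vec i (bd f) $ a"
    using a by (simp add: to_vec_def)
qed (simp add: to_vec_def bd_mat_def)

lemma aug_vec_carrier [simp]: "aug_vec \<in> carrier_vec (rank 0)"
  by (simp add: aug_vec_def)

lemma cells_of_0: "cells_of 0 = (\<lambda>C. ({}, C)) ` M"
  by (auto simp: cells_of_def cells_def)

lemma aug_vec_mult: "aug_vec \<bullet> to_vec 0 f = aug f"
proof -
  have "aug_vec \<bullet> to_vec 0 f = (\<Sum>c\<in>cells_of 0. cover_monomial (snd c) * f c)"
    by (simp add: aug_vec_def to_vec_def scalar_prod_def sum_enum[where f = "\<lambda>c. cover_monomial (snd c) * f c"])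
  also have "\<dots> = aug f"
    unfolding cells_of_0 aug_def by (subst sum.reindex) (auto simp: inj_on_def)
  finally show ?thesis .
qed

lemma aug_image: "(\<lambda>v. aug_vec \<bullet> v) ` carrier_vec (rank 0) = ideal_gen (cover_monomial ` M)"
proof (intro equalityI subsetI)
  fix p :: "('v, 'k::field) mpol" assume "p \<in> (\<lambda>v. aug_vec \<bullet> v) ` carrier_vec (rank 0)"
  then obtain f where p: "p = aug f" by (auto simp: carrier_vec_eq_to_vec aug_vec_mult)
  show "p \<in> ideal_gen (cover_monomial ` M)"
    unfolding p aug_def
  proof (rule ring.span_sum)
    fix C assume "C \<in> M"
    then show "cover_monomial C * f ({}, C) \<in> ideal_gen (cover_monomial ` M)"
      by (subst mult.commute) (intro ring.span_scale ring.span_base imageI)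
  qed
next
  fix p :: "('v, 'k::field) mpol" assume "p \<in> ideal_gen (cover_monomial ` M)"
  then have "\<exists>f. supported_in 0 f \<and> p = aug f"
  proof (induction rule: ring.span_induct_alt)
    case base
    then show ?case by (intro exI[of _ "\<lambda>_. 0"]) (simp add: supported_in_zero aug_def)
  next
    case (step a x y)
    from step(1) obtain C where C: "C \<in> M" "x = cover_monomial C" by auto
    from step.IH obtain f where f: "supported_in 0 f" "y = aug f" by blast
    define g where "g c = f c + (if c = ({}, C) then a else 0)" for c
    have "supported_in 0 g" using f(1) C(1) by (auto simp: supported_in_def g_def cells_of_0)
    moreover have "cover_monomial D * g ({}, D) =
        cover_monomial D * f ({}, D) + (if D = C then cover_monomial C * a else 0)" for D
      by (simp add: g_def distrib_left)
    then have "aug g = a * x + y" using C by (simp add: aug_def sum.distrib f(2) mult.commute)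
    ultimately show ?case by auto
  qed
  then obtain f where "supported_in 0 f" "p = aug f" by blast
  then show "p \<in> (\<lambda>v. aug_vec \<bullet> v) ` carrier_vec (rank 0)"
    by (intro image_eqI[of _ _ "to_vec 0 f"]) (simp_all add: aug_vec_mult)
qed

lemma kernel_aug:
  "{v \<in> carrier_vec (rank 0). aug_vec \<bullet> v = 0} =
     (\<lambda>v. bd_mat 0 *\<^sub>v v) ` (carrier_vec (rank 1) :: ('v, 'k::field) mpol vec set)"
proof (intro equalityI subsetI)
  fix v :: "('v, 'k) mpol vec" assume "v \<in> {v \<in> carrier_vec (rank 0). aug_vec \<bullet> v = 0}"
  then obtain f where f: "supported_in 0 f" "v = to_vec 0 f" "aug_vec \<bullet> to_vec 0 f = 0"
    unfolding carrier_vec_eq_to_vec by auto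
  \<comment> \<open>In dimension zero the boundary vanishes for lack of smaller cells; the actual
    cycle condition is \<open>aug f = 0\<close>.\<close>
  have "bd f c = 0" for c using f(1) by (cases c) (simp add: bd_support)
  then obtain g where "supported g" "\<And>c. f c = bd g c"
    using bd_exact[OF supported_in_imp[OF f(1)] _ f(3)[unfolded aug_vec_mult]] by blast
  then have "f = bd g" "supported g" by auto
  then obtain h where h: "supported_in (Suc 0) h" "f = bd h" using bd_cycle_exact[OF f(1)] by blast
  show "v \<in> (\<lambda>v. bd_mat 0 *\<^sub>v v) ` carrier_vec (rank 1)"
    by (rule image_eqI[of _ _ "to_vec (Suc 0) h"]) (use bd_mat_mult[OF h(1)] h(2) f(2) in simp_all)
next
  fix v :: "('v, 'k) mpol vec" assume "v \<in> (\<lambda>v. bd_mat 0 *\<^sub>v v) ` carrier_vec (rank 1)"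
  then obtain f where "supported_in (Suc 0) f" "v = bd_mat 0 *\<^sub>v to_vec (Suc 0) f"
    unfolding carrier_vec_eq_to_vec by auto
  then show "v \<in> {v \<in> carrier_vec (rank 0). aug_vec \<bullet> v = 0}"
    by (simp add: bd_mat_mult aug_vec_mult aug_bd supported_in_imp)
qed

lemma kernel_bd_mat:
  "{v \<in> carrier_vec (rank (Suc i)). bd_mat i *\<^sub>v v = 0\<^sub>v (rank i)} =
     (\<lambda>v. bd_mat (Suc i) *\<^sub>v v) ` (carrier_vec (rank (Suc (Suc i))) :: ('v, 'k::field) mpol vec set)"
proof (intro equalityI subsetI)
  fix v :: "('v, 'k) mpol vec"
  assume "v \<in> {v \<in> carrier_vec (rank (Suc i)). bd_mat i *\<^sub>v v = 0\<^sub>v (rank i)}"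
  then obtain f where f: "supported_in (Suc i) f" "v = to_vec (Suc i) f"
    "bd_mat i *\<^sub>v to_vec (Suc i) f = 0\<^sub>v (rank i)"
    unfolding carrier_vec_eq_to_vec by auto
  have "bd f = (\<lambda>_. 0)"
    using f(3) to_vec_eq_iff[OF supported_in_bd[OF f(1)] supported_in_zero]
    unfolding bd_mat_mult[OF f(1)] to_vec_zero by simp
  then have "bd f c = 0" for c by simp
  \<comment> \<open>In positive dimension \<open>f\<close> has no coefficient at an empty set, which
    is all the augmentation reads.\<close>
  moreover have "aug f = 0" using f(1) by (simp add: aug_def supported_in_def cells_of_def)
  ultimately obtain g where "supported g" "\<And>c. f c = bd g c"
    using bd_exact[OF supported_in_imp[OF f(1)]] by blast
  then have "f = bd g" "supported g" by auto
  then obtain h where h: "supported_in (Suc (Suc i)) h" "f = bd h" using bd_cycle_exact[OF f(1)] by blast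
  show "v \<in> (\<lambda>v. bd_mat (Suc i) *\<^sub>v v) ` carrier_vec (rank (Suc (Suc i)))"
    by (rule image_eqI[of _ _ "to_vec (Suc (Suc i)) h"]) (use bd_mat_mult[OF h(1)] h(2) f(2) in simp_all)
next
  fix v :: "('v, 'k) mpol vec" assume "v \<in> (\<lambda>v. bd_mat (Suc i) *\<^sub>v v) ` carrier_vec (rank (Suc (Suc i)))"
  then obtain f where f: "supported_in (Suc (Suc i)) f" "v = bd_mat (Suc i) *\<^sub>v to_vec (Suc (Suc i)) f"
    unfolding carrier_vec_eq_to_vec by auto
  have "bd (bd f) = (\<lambda>_. 0)" using bd_bd[OF supported_in_imp[OF f(1)]] by (intro ext)
  then show "v \<in> {v \<in> carrier_vec (rank (Suc i)). bd_mat i *\<^sub>v v = 0\<^sub>v (rank i)}"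
    using f supported_in_bd[OF f(1)] by (simp add: bd_mat_mult to_vec_zero)
qed

lemma bd_cell_fun:
  fixes c :: "'v set \<times> 'v set"
  shows "ihom 1 (bd (cell_fun c') c :: ('v, 'k::field) mpol)"
    and "bd (cell_fun c') c \<in> (irrelevant_ideal :: ('v, 'k) mpol set)"
proof -
  obtain T D where TD: "c = (T, D)" by (cases c)
  define g :: "'v \<Rightarrow> 'v set \<Rightarrow> ('v, 'k) mpol" where "g s = (\<lambda>D. cell_fun c' (insert s T, D))" for s
  have g: "ihom 0 (g s D)" for s D by (simp add: g_def cell_fun_def ihom_one)
  have "ihom 1 (edge_op s (g s) D)" for s
    using ihom_mult[OF ihom_var g] by (auto simp: edge_op_def intro!: ihom_diff)
  moreover have "ihom 0 (ksgn s T :: ('v, 'k) mpol)" for s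
    by (simp add: ksgn_def minus_one_power_iff ihom_one ihom_uminus)
  ultimately have "ihom 1 (ksgn s T * edge_op s (g s) D)" for s
    using ihom_mult[of 0 "ksgn s T" 1 "edge_op s (g s) D"] by simp
  then show "ihom 1 (bd (cell_fun c') c :: ('v, 'k) mpol)"
    by (simp add: TD bd_def ihom_sum flip: g_def)
  have var: "var v * q \<in> (irrelevant_ideal :: ('v, 'k) mpol set)" for v q
    using var_irrelevant unfolding irrelevant_ideal_def
    by (subst mult.commute) (rule ring.span_scale)
  have "edge_op s (g s) D \<in> irrelevant_ideal" for s
    using var unfolding edge_op_def irrelevant_ideal_def
    by (auto intro: ring.span_diff ring.span_zero)
  then show "bd (cell_fun c') c \<in> (irrelevant_ideal :: ('v, 'k) mpol set)"
    unfolding irrelevant_ideal_def TD bd_def prod.case g_def[symmetric]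
    by (intro ring.span_sum ring.span_scale)
qed

text \<open>The resolution is linear: the generators have degree \<open>card V'\<close> by
  \<open>card_eq\<close>, and every entry of a differential is a linear form.\<close>

lemma minimal_resolution:
  "minimal_graded_free_resolution (ideal_gen (cover_monomial ` M) :: ('v, 'k::field) mpol set)
     rank (\<lambda>i _. card V' + i) aug_vec bd_mat"
  unfolding minimal_graded_free_resolution_def projective_resolution_def
proof (intro conjI allI impI)
  show "homogeneous_of_degree (card V' + 0) (aug_vec $ a :: ('v, 'k) mpol)" if "a < rank 0" for a
  proof -
    have "enum 0 a \<in> (\<lambda>C. ({}, C)) ` M" using enum_in[of a 0] that by (simp add: cells_of_0)
    then obtain C where "C \<in> M" "enum 0 a = ({}, C)" by blast
    then show ?thesis using that ihom_prod_var[of C, where 'k = 'k]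
      by (simp add: aug_vec_def cover_monomial_def card_eq flip: ihom_of_nat)
  qed
  fix i a b assume ab: "a < rank i" "b < rank (Suc i)"
  have "ihom (int 1) (bd_mat i $$ (a, b) :: ('v, 'k) mpol)"
    using ab bd_cell_fun(1) by (simp add: bd_mat_def)
  then have "homogeneous_of_degree 1 (bd_mat i $$ (a, b) :: ('v, 'k) mpol)"
    unfolding ihom_of_nat .
  then show "if card V' + i \<le> card V' + Suc i
      then homogeneous_of_degree (card V' + Suc i - (card V' + i)) (bd_mat i $$ (a, b) :: ('v, 'k) mpol)
      else bd_mat i $$ (a, b) = (0 :: ('v, 'k) mpol)" by simp
  show "bd_mat i $$ (a, b) \<in> (irrelevant_ideal :: ('v, 'k) mpol set)"
    using ab bd_cell_fun(2) by (simp add: bd_mat_def)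
qed (simp_all add: direct_summand_carrier_vec aug_image kernel_aug[simplified] kernel_bd_mat)

lemma rank_eq: "rank i = (\<Sum>C\<in>M. card (V' - C) choose i)"
proof -
  have "bij_betw prod.swap (SIGMA C:M. {T. T \<subseteq> V' - C \<and> card T = i}) (cells_of i)"
    by (intro bij_betwI[where g = prod.swap]) (auto simp: cells_of_def cells_def)
  then have "rank i = card (SIGMA C:M. {T. T \<subseteq> V' - C \<and> card T = i})"
    unfolding rank_def by (rule bij_betw_same_card[symmetric])
  then show ?thesis by (simp add: n_subsets)
qed

end

section \<open>Betti numbers and projective dimension\<close>

context swap_family
begin

lemma betti_formula:
  "betti i (ideal_gen (cover_monomial ` M) :: ('v, 'k::field) mpol set) =
     (\<Sum>C\<in>M. card (V' - C) choose i)"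
  unfolding betti_eq_rank[OF minimal_resolution] rank_eq ..

text \<open>By linearity all basis elements in step \<open>i\<close> share one degree. The formula
  no longer refers to the field, which gives independence of the characteristic.\<close>

lemma graded_betti_formula:
  "graded_betti i j (ideal_gen (cover_monomial ` M) :: ('v, 'k::field) mpol set) =
     (if j = card V' + i then \<Sum>C\<in>M. card (V' - C) choose i else 0)"
  by (auto simp: graded_betti_eq_card[OF minimal_resolution] simp flip: rank_eq)

text \<open>A summand \<open>card (V' - C) choose i\<close> survives exactly up to
  \<open>i = card (V' - C)\<close>, so the last nonzero rank sits at the maximum.\<close>

lemma projective_dimension_formula:
  assumes "M \<noteq> {}"
  shows "projective_dimension (ideal_gen (cover_monomial ` M) :: ('v, 'k::field) mpol set) =
    enat (Max {card (V' - C) | C. C \<in> M})"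
proof -
  define L where "L = {card (V' - C) | C. C \<in> M}"
  have L: "finite L" "L \<noteq> {}" using assms by (auto simp: L_def)
  obtain C where C: "C \<in> M" "card (V' - C) = Max L"
    using Max_in[OF L] by (auto simp: L_def)
  have le: "card (V' - C) \<le> Max L" if "C \<in> M" for C
    using that L by (intro Max_ge) (auto simp: L_def)
  have "rank (Max L) \<noteq> 0"
    unfolding rank_eq using C by (auto intro!: bexI[of _ C])
  moreover have "rank i = 0" if "Max L < i" for i
    unfolding rank_eq using le that by (intro sum.neutral) (fastforce simp: binomial_eq_0_iff)
  ultimately show ?thesis
    unfolding L_def[symmetric] by (rule projective_dimension_eq[OF minimal_resolution])
qed

end


section \<open>Vertex covers\<close>

lemma min_vertex_cover_exists:
  fixes C :: "'v::finite set"
  assumes "vertex_cover E C"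
  shows "\<exists>D\<in>min_vertex_covers E. D \<subseteq> C"
  using finite[of C] assms
proof (induction C rule: finite_psubset_induct)
  case (psubset C)
  show ?case
  proof (cases "C \<in> min_vertex_covers E")
    case False
    then obtain D where "D \<subset> C" "vertex_cover E D"
      using psubset.prems by (auto simp: min_vertex_covers_def)
    then show ?thesis using psubset.IH[of D] by blast
  qed blast
qed

lemma min_vertex_covers_nonempty:
  assumes "simple_graph E"
  shows "min_vertex_covers E \<noteq> {}"
proof -
  have "vertex_cover E UNIV" using assms by (auto simp: vertex_cover_def simple_graph_def)
  then show ?thesis using min_vertex_cover_exists[of E UNIV] by blast
qed

lemma cover_ideal_eq_min:
  "cover_ideal E = ideal_gen (cover_monomial ` min_vertex_covers E :: ('v::finite, 'k::field) mpol set)"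
  unfolding cover_ideal_def cover_monomial_def[symmetric]
proof (rule antisym)
  show "ideal_gen (cover_monomial ` min_vertex_covers E) \<subseteq>
      ideal_gen (cover_monomial ` {C. vertex_cover E C} :: ('v, 'k) mpol set)"
    by (intro ring.span_mono image_mono) (auto simp: min_vertex_covers_def)
  show "ideal_gen (cover_monomial ` {C. vertex_cover E C} :: ('v, 'k) mpol set) \<subseteq>
      ideal_gen (cover_monomial ` min_vertex_covers E)"
  proof (rule ring.span_minimal[OF _ ring.subspace_span], rule subsetI)
    fix p :: "('v, 'k) mpol" assume "p \<in> cover_monomial ` {C. vertex_cover E C}"
    then obtain C where C: "p = cover_monomial C" "vertex_cover E C" by auto
    obtain D where D: "D \<in> min_vertex_covers E" "D \<subseteq> C" using min_vertex_cover_exists[OF C(2)] by blast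
    have "p = (\<Prod>v\<in>C - D. var v) * cover_monomial D"
      unfolding C(1) cover_monomial_def using D(2) by (intro prod.subset_diff) auto
    then show "p \<in> ideal_gen (cover_monomial ` min_vertex_covers E)"
      using D(1) by (simp only:) (intro ring.span_scale ring.span_base imageI)
  qed
qed

lemma disjoint_image_neq: "f ` A \<inter> g ` B = {} \<Longrightarrow> a \<in> A \<Longrightarrow> b \<in> B \<Longrightarrow> f a \<noteq> g b"
  by blast

text \<open>Fixes the bipartite part \<open>B\<close>, whose existence alone is asserted by
  \<open>leaf_triangle_structure\<close>.\<close>

locale leaf_triangle =
  fixes E B :: "'v::finite set set" and n m :: nat and x y z w :: "nat \<Rightarrow> 'v"
  assumes inj: "inj_on x {1..n}" "inj_on y {1..m}" "inj_on z {1..m}" "inj_on w {1..n + m}"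
    and disj: "x ` {1..n} \<inter> y ` {1..m} = {}" "x ` {1..n} \<inter> z ` {1..m} = {}"
      "x ` {1..n} \<inter> w ` {1..n + m} = {}" "y ` {1..m} \<inter> z ` {1..m} = {}"
      "y ` {1..m} \<inter> w ` {1..n + m} = {}" "z ` {1..m} \<inter> w ` {1..n + m} = {}"
    and UNIV_eq: "x ` {1..n} \<union> y ` {1..m} \<union> z ` {1..m} \<union> w ` {1..n + m} = UNIV"
    and B: "B \<subseteq> {{x i, y j} | i j. i \<in> {1..n} \<and> j \<in> {1..m}}"
    and E: "E = B \<union> {{x i, w i} | i. i \<in> {1..n}}
                \<union> (\<Union>j\<in>{1..m}. {{y j, z j}, {y j, w (n + j)}, {z j, w (n + j)}})"
begin

text \<open>Opaque names for the index ranges keep membership an atom for the simplifier, so that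
  the distinctness rules match.\<close>

definition I where "I = {1..n}"
definition K where "K = {1..m}"

lemmas inj_IK = inj[folded I_def K_def]
  and disj_IK = disj[folded I_def K_def]
  and UNIV_IK = UNIV_eq[folded I_def K_def]
  and B_IK = B[folded I_def K_def]
  and E_IK = E[folded I_def K_def]

lemma w_index: "i \<in> I \<Longrightarrow> i \<in> {1..n + m}" "j \<in> K \<Longrightarrow> n + j \<in> {1..n + m}"
  by (auto simp: I_def K_def)

lemma neq:
  "i \<in> I \<Longrightarrow> j \<in> K \<Longrightarrow> x i \<noteq> y j" "i \<in> I \<Longrightarrow> j \<in> K \<Longrightarrow> x i \<noteq> z j"
  "i \<in> I \<Longrightarrow> i' \<in> I \<Longrightarrow> x i \<noteq> w i'" "i \<in> I \<Longrightarrow> j \<in> K \<Longrightarrow> x i \<noteq> w (n + j)"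
  "j \<in> K \<Longrightarrow> j' \<in> K \<Longrightarrow> y j \<noteq> z j'"
  "j \<in> K \<Longrightarrow> i \<in> I \<Longrightarrow> y j \<noteq> w i" "j \<in> K \<Longrightarrow> j' \<in> K \<Longrightarrow> y j \<noteq> w (n + j')"
  "j \<in> K \<Longrightarrow> i \<in> I \<Longrightarrow> z j \<noteq> w i" "j \<in> K \<Longrightarrow> j' \<in> K \<Longrightarrow> z j \<noteq> w (n + j')"
  by (rule disjoint_image_neq[OF disj_IK(1)] disjoint_image_neq[OF disj_IK(2)] disjoint_image_neq[OF disj_IK(3)]
        disjoint_image_neq[OF disj_IK(4)] disjoint_image_neq[OF disj_IK(5)] disjoint_image_neq[OF disj_IK(6)];
      (assumption | erule w_index))+

lemma w_neq: "i \<in> I \<Longrightarrow> j \<in> K \<Longrightarrow> w i \<noteq> w (n + j)"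
  by (subst inj_on_eq_iff[OF inj(4) w_index(1) w_index(2)]) (simp_all add: I_def K_def)

lemma w_inj: "i \<in> I \<Longrightarrow> i' \<in> I \<Longrightarrow> w i = w i' \<longleftrightarrow> i = i'"
  "j \<in> K \<Longrightarrow> j' \<in> K \<Longrightarrow> w (n + j) = w (n + j') \<longleftrightarrow> j = j'"
  using inj_on_eq_iff[OF inj(4) w_index(1) w_index(1)] inj_on_eq_iff[OF inj(4) w_index(2) w_index(2)]
  by simp_all

lemma x_inj: "i \<in> I \<Longrightarrow> i' \<in> I \<Longrightarrow> x i = x i' \<longleftrightarrow> i = i'"
  and y_inj: "j \<in> K \<Longrightarrow> j' \<in> K \<Longrightarrow> y j = y j' \<longleftrightarrow> j = j'"
  and z_inj: "j \<in> K \<Longrightarrow> j' \<in> K \<Longrightarrow> z j = z j' \<longleftrightarrow> j = j'"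
  using inj_IK(1-3) by (simp_all add: inj_on_eq_iff)

lemmas distinct = neq neq[THEN not_sym] w_neq w_neq[THEN not_sym] w_inj x_inj y_inj z_inj

lemma vertex_cases:
  obtains (x) i where "v = x i" "i \<in> I" | (y) j where "v = y j" "j \<in> K"
    | (z) j where "v = z j" "j \<in> K" | (w) i where "v = w i" "i \<in> I"
    | (w') j where "v = w (n + j)" "j \<in> K"
proof -
  have "v \<in> x ` I \<or> v \<in> y ` K \<or> v \<in> z ` K \<or> v \<in> w ` {1..n + m}" using UNIV_IK by blast
  moreover have "k \<in> I \<or> (\<exists>j\<in>K. k = n + j)" if "k \<in> {1..n + m}" for k
    using that by (cases "k \<le> n") (auto simp: I_def K_def intro!: bexI[of _ "k - n"])
  ultimately show ?thesis using that by blast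
qed

definition V' :: "'v set" where
  "V' = x ` I \<union> y ` K \<union> z ` K"

text \<open>The partner of a vertex is the \<open>w\<close> vertex of its leaf edge or triangle.
  Outside \<open>V'\<close> the value is arbitrary.\<close>

definition om :: "'v \<Rightarrow> 'v" where
  "om v = (if v \<in> x ` I then w (inv_into I x v)
     else if v \<in> y ` K then w (n + inv_into K y v) else w (n + inv_into K z v))"

lemma om_simps [simp]:
  "i \<in> I \<Longrightarrow> om (x i) = w i" "j \<in> K \<Longrightarrow> om (y j) = w (n + j)" "j \<in> K \<Longrightarrow> om (z j) = w (n + j)"
proof -
  show "om (x i) = w i" if "i \<in> I" using that inj_IK(1) by (simp add: om_def)
  show "om (y j) = w (n + j)" if "j \<in> K"
  proof -
    have "y j \<notin> x ` I" "y j \<in> y ` K" using that disj_IK(1) by blast+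
    then show ?thesis using that inj_IK(2) by (simp add: om_def)
  qed
  show "om (z j) = w (n + j)" if "j \<in> K"
  proof -
    have "z j \<notin> x ` I" "z j \<notin> y ` K" using that disj_IK(2,4) by blast+
    then show ?thesis using that inj_IK(3) by (simp add: om_def)
  qed
qed

lemma in_V': "v \<in> V' \<longleftrightarrow> (\<exists>i\<in>I. v = x i) \<or> (\<exists>j\<in>K. v = y j) \<or> (\<exists>j\<in>K. v = z j)"
  by (auto simp: V'_def)

lemma w_notin_V': "i \<in> I \<Longrightarrow> w i \<notin> V'" "j \<in> K \<Longrightarrow> w (n + j) \<notin> V'"
  unfolding in_V' using distinct by metis+

section \<open>Minimal covers of the leaf edges and triangles\<close>

lemma vertex_cover_iff:
  "vertex_cover E C \<longleftrightarrow> vertex_cover B C \<and> (\<forall>i\<in>I. x i \<in> C \<or> w i \<in> C) \<and>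
     (\<forall>j\<in>K. (y j \<in> C \<or> z j \<in> C) \<and> (y j \<in> C \<or> w (n + j) \<in> C) \<and> (z j \<in> C \<or> w (n + j) \<in> C))"
proof -
  have pair: "{a, b} \<inter> C \<noteq> {} \<longleftrightarrow> a \<in> C \<or> b \<in> C" for a b by blast
  have "(\<forall>e\<in>{{x i, w i} | i. i \<in> I}. e \<inter> C \<noteq> {}) \<longleftrightarrow> (\<forall>i\<in>I. x i \<in> C \<or> w i \<in> C)"
    by (simp only: setcompr_eq_image ball_simps pair) (simp only: Ball_def)
  moreover have "(\<forall>e\<in>(\<Union>j\<in>K. {{y j, z j}, {y j, w (n + j)}, {z j, w (n + j)}}). e \<inter> C \<noteq> {}) \<longleftrightarrow>
      (\<forall>j\<in>K. (y j \<in> C \<or> z j \<in> C) \<and> (y j \<in> C \<or> w (n + j) \<in> C) \<and> (z j \<in> C \<or> w (n + j) \<in> C))"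
    by (simp only: ball_UN ball_simps pair simp_thms conj_assoc)
  ultimately show ?thesis unfolding E_IK vertex_cover_def ball_Un by argo
qed

lemma vertex_coverD:
  assumes "vertex_cover E C"
  shows "vertex_cover B C" "i \<in> I \<Longrightarrow> x i \<in> C \<or> w i \<in> C" "j \<in> K \<Longrightarrow> y j \<in> C \<or> z j \<in> C"
    "j \<in> K \<Longrightarrow> y j \<in> C \<or> w (n + j) \<in> C" "j \<in> K \<Longrightarrow> z j \<in> C \<or> w (n + j) \<in> C"
  using assms unfolding vertex_cover_iff by simp_all

lemma vertex_cover_B_mono:
  assumes "vertex_cover B C" "\<And>i. i \<in> I \<Longrightarrow> x i \<in> C \<Longrightarrow> x i \<in> D" "\<And>j. j \<in> K \<Longrightarrow> y j \<in> C \<Longrightarrow> y j \<in> D"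
  shows "vertex_cover B D"
  unfolding vertex_cover_def
proof
  fix e assume e: "e \<in> B"
  then obtain i j where ij: "i \<in> I" "j \<in> K" "e = {x i, y j}" using B_IK by blast
  have "e \<inter> C \<noteq> {}" using assms(1) e unfolding vertex_cover_def by blast
  then show "e \<inter> D \<noteq> {}" using assms(2,3) ij by blast
qed

text \<open>No waste: a single vertex suffices for a leaf edge, and two suffice for a
  triangle.\<close>

definition tight :: "'v set \<Rightarrow> bool" where
  "tight C \<longleftrightarrow> (\<forall>i\<in>I. x i \<notin> C \<or> w i \<notin> C) \<and> (\<forall>j\<in>K. y j \<notin> C \<or> z j \<notin> C \<or> w (n + j) \<notin> C)"

lemma min_vertex_covers_eq: "min_vertex_covers E = {C. vertex_cover E C \<and> tight C}"
proof (intro equalityI subsetI)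
  fix C assume C: "C \<in> min_vertex_covers E"
  then have cover: "vertex_cover E C" and min: "\<And>v. v \<in> C \<Longrightarrow> \<not> vertex_cover E (C - {v})"
    unfolding min_vertex_covers_def by blast+
  have "x i \<notin> C \<or> w i \<notin> C" if i: "i \<in> I" for i
  proof (rule ccontr)
    assume "\<not> ?thesis"
    then have *: "x i \<in> C" "w i \<in> C" by auto
    have "vertex_cover E (C - {w i})"
      unfolding vertex_cover_iff
    proof (intro conjI ballI)
      show "vertex_cover B (C - {w i})"
        using i by (intro vertex_cover_B_mono[OF vertex_coverD(1)[OF cover]]) (simp_all add: distinct)
      show "x k \<in> C - {w i} \<or> w k \<in> C - {w i}" if "k \<in> I" for k
        using vertex_coverD(2)[OF cover that] * i that by (cases "k = i") (auto simp: distinct)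
      fix j assume j: "j \<in> K"
      show "y j \<in> C - {w i} \<or> z j \<in> C - {w i}" "y j \<in> C - {w i} \<or> w (n + j) \<in> C - {w i}"
        "z j \<in> C - {w i} \<or> w (n + j) \<in> C - {w i}"
        using vertex_coverD(3-5)[OF cover j] i j by (auto simp: distinct)
    qed
    then show False using min *(2) by blast
  qed
  moreover have "y j \<notin> C \<or> z j \<notin> C \<or> w (n + j) \<notin> C" if j: "j \<in> K" for j
  proof (rule ccontr)
    assume "\<not> ?thesis"
    then have *: "y j \<in> C" "z j \<in> C" "w (n + j) \<in> C" by auto
    let ?D = "C - {w (n + j)}"
    have "vertex_cover E ?D"
      unfolding vertex_cover_iff
    proof (intro conjI ballI)
      show "vertex_cover B ?D"
        using j by (intro vertex_cover_B_mono[OF vertex_coverD(1)[OF cover]]) (simp_all add: distinct)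
      show "x i \<in> ?D \<or> w i \<in> ?D" if "i \<in> I" for i
        using vertex_coverD(2)[OF cover that] j that by (auto simp: distinct)
      fix k assume k: "k \<in> K"
      show "y k \<in> ?D \<or> z k \<in> ?D" "y k \<in> ?D \<or> w (n + k) \<in> ?D" "z k \<in> ?D \<or> w (n + k) \<in> ?D"
        using vertex_coverD(3-5)[OF cover k] * j k by (cases "k = j"; auto simp: distinct)+
    qed
    then show False using min *(3) by blast
  qed
  ultimately show "C \<in> {C. vertex_cover E C \<and> tight C}" using cover by (simp add: tight_def)
next
  fix C assume "C \<in> {C. vertex_cover E C \<and> tight C}"
  then have C: "vertex_cover E C" "tight C" by auto
  have "\<not> vertex_cover E D" if D: "D \<subset> C" for D
  proof
    assume D': "vertex_cover E D"
    obtain v where v: "v \<in> C" "v \<notin> D" using D by blast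
    have sub: "u \<notin> D" if "u \<notin> C" for u using D that by blast
    note D'' = vertex_coverD(2-5)[OF D'] and tight = C(2)[unfolded tight_def]
    show False
    proof (cases v rule: vertex_cases)
      case (x i)
      then show ?thesis using D''(1)[of i] tight v sub by blast
    next
      case (y j)
      then show ?thesis using D''(2-3)[of j] tight v sub by blast
    next
      case (z j)
      then show ?thesis using D''(2,4)[of j] tight v sub by blast
    next
      case (w i)
      then show ?thesis using D''(1)[of i] tight v sub by blast
    next
      case (w' j)
      then show ?thesis using D''(3-4)[of j] tight v sub by blast
    qed
  qed
  then show "C \<in> min_vertex_covers E" using C(1) by (simp add: min_vertex_covers_def)
qed

text \<open>The removed vertex \<open>om s\<close> lies on no edge of \<open>B\<close>, and its
  exchange for \<open>s\<close> keeps one vertex of the leaf edge or two of the triangle.\<close>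

lemma min_cover_swap:
  assumes C: "C \<in> min_vertex_covers E" and s: "s \<in> V' - C"
  shows "insert s (C - {om s}) \<in> min_vertex_covers E"
proof -
  have cover: "vertex_cover B C" "\<And>i. i \<in> I \<Longrightarrow> x i \<in> C \<longleftrightarrow> w i \<notin> C"
    "\<And>j. j \<in> K \<Longrightarrow> y j \<in> C \<or> z j \<in> C" "\<And>j. j \<in> K \<Longrightarrow> y j \<in> C \<or> w (n + j) \<in> C"
    "\<And>j. j \<in> K \<Longrightarrow> z j \<in> C \<or> w (n + j) \<in> C" "\<And>j. j \<in> K \<Longrightarrow> y j \<notin> C \<or> z j \<notin> C \<or> w (n + j) \<notin> C"
    using C unfolding min_vertex_covers_eq vertex_cover_iff tight_def by blast+
  let ?D = "insert s (C - {om s})"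
  consider (1) k where "k \<in> I" "s = x k" "x k \<notin> C" | (2) k where "k \<in> K" "s = y k" "y k \<notin> C"
    | (3) k where "k \<in> K" "s = z k" "z k \<notin> C"
    using s by (auto simp: in_V')
  note cases = this
  have om: "om s \<noteq> x i" if "i \<in> I" for i
    using s that by (auto simp: in_V' distinct)
  have om': "om s \<noteq> y j" if "j \<in> K" for j
    using s that by (auto simp: in_V' distinct)
  have "vertex_cover B ?D"
    using om om' by (intro vertex_cover_B_mono[OF cover(1)]) (metis Diff_iff insertCI singletonD)+
  moreover have "x i \<in> ?D \<longleftrightarrow> w i \<notin> ?D" if i: "i \<in> I" for i
    using cases
  proof cases
    case (1 k)
    then show ?thesis using i cover(2)[OF i] by (cases "i = k") (simp_all add: distinct)
  next
    case (2 k)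
    then show ?thesis using i cover(2)[OF i] by (simp add: distinct)
  next
    case (3 k)
    then show ?thesis using i cover(2)[OF i] by (simp add: distinct)
  qed
  moreover have "(y j \<in> ?D \<or> z j \<in> ?D) \<and> (y j \<in> ?D \<or> w (n + j) \<in> ?D) \<and> (z j \<in> ?D \<or> w (n + j) \<in> ?D) \<and>
      (y j \<notin> ?D \<or> z j \<notin> ?D \<or> w (n + j) \<notin> ?D)" if j: "j \<in> K" for j
    using cases
  proof cases
    case (1 k)
    then show ?thesis using j cover(3-6)[OF j] by (simp add: distinct)
  next
    case (2 k)
    then show ?thesis using j cover(3-6)[OF j] by (cases "j = k") (simp_all add: distinct)
  next
    case (3 k)
    then show ?thesis using j cover(3-6)[OF j] by (cases "j = k") (simp_all add: distinct)
  qed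
  ultimately show ?thesis
    unfolding min_vertex_covers_eq vertex_cover_iff tight_def by blast
qed

sublocale swap_family V' om "min_vertex_covers E"
proof
  show "om v \<notin> V'" if "v \<in> V'" for v
    using that w_notin_V' by (auto simp: in_V'[of v])
  fix C assume C: "C \<in> min_vertex_covers E"
  have cover: "\<And>i. i \<in> I \<Longrightarrow> x i \<in> C \<longleftrightarrow> w i \<notin> C"
    "\<And>j. j \<in> K \<Longrightarrow> y j \<in> C \<or> z j \<in> C" "\<And>j. j \<in> K \<Longrightarrow> y j \<in> C \<or> w (n + j) \<in> C"
    "\<And>j. j \<in> K \<Longrightarrow> z j \<in> C \<or> w (n + j) \<in> C" "\<And>j. j \<in> K \<Longrightarrow> y j \<notin> C \<or> z j \<notin> C \<or> w (n + j) \<notin> C"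
    using C unfolding min_vertex_covers_eq vertex_cover_iff tight_def by blast+
  show "C = (C \<inter> V') \<union> om ` (V' - C)"
  proof (intro equalityI subsetI)
    fix v assume v: "v \<in> C"
    show "v \<in> (C \<inter> V') \<union> om ` (V' - C)"
    proof (cases v rule: vertex_cases)
      case (w i)
      then have "x i \<in> V' - C" "om (x i) = v" using cover(1) v by (auto simp: in_V')
      then show ?thesis by blast
    next
      \<comment> \<open>Tightness leaves out \<open>y j\<close> or \<open>z j\<close>, and
        \<open>om\<close> sends both to \<open>w (n + j)\<close>.\<close>
      case (w' j)
      then have "y j \<in> V' - C \<or> z j \<in> V' - C" and om: "om (y j) = v" "om (z j) = v"
        using cover(5) v by (auto simp: in_V')
      from this(1) have "v \<in> om ` (V' - C)"
      proof
        assume "y j \<in> V' - C"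
        from imageI[OF this, of om] show ?thesis unfolding om .
      next
        assume "z j \<in> V' - C"
        from imageI[OF this, of om] show ?thesis unfolding om .
      qed
      then show ?thesis by blast
    next
      case (x i)
      then have "v \<in> V'" unfolding in_V' by blast
      then show ?thesis using v by blast
    next
      case (y j)
      then have "v \<in> V'" unfolding in_V' by blast
      then show ?thesis using v by blast
    next
      case (z j)
      then have "v \<in> V'" unfolding in_V' by blast
      then show ?thesis using v by blast
    qed
  next
    have "om s \<in> C" if s: "s \<in> V'" "s \<notin> C" for s
    proof -
      from s(1) consider (1) i where "i \<in> I" "s = x i" | (2) j where "j \<in> K" "s = y j"
        | (3) j where "j \<in> K" "s = z j" unfolding in_V' by blast
      then show ?thesis
      proof cases
        case (1 i)
        then show ?thesis using s(2) cover(1)[of i] by simp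
      next
        case (2 j)
        then show ?thesis using s(2) cover(3)[of j] by simp
      next
        case (3 j)
        then show ?thesis using s(2) cover(4)[of j] by simp
      qed
    qed
    then show "v \<in> C" if "v \<in> (C \<inter> V') \<union> om ` (V' - C)" for v using that by blast
  qed
  \<comment> \<open>Only \<open>y j\<close> and \<open>z j\<close> share a value of
    \<open>om\<close>, and the edge between them keeps one of the two in \<open>C\<close>.\<close>
  show "inj_on om (V' - C)"
  proof (rule inj_onI)
    fix s t assume "s \<in> V' - C" "t \<in> V' - C" "om s = om t"
    then show "s = t" using cover(2) unfolding in_V' Diff_iff
      by (elim conjE disjE bexE) (auto simp: distinct)
  qed
qed (rule min_cover_swap)

end

lemma leaf_triangleI:
  assumes "leaf_triangle_structure E n m x y z w"
  obtains B where "leaf_triangle E B n m x y z w"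
  using assms unfolding leaf_triangle_structure_def leaf_triangle_def by blast

theorem corollary4p17:
  fixes E :: "'v::finite set set"
    and n m :: nat
    and x y z w :: "nat \<Rightarrow> 'v"
    and V' :: "'v set"
  assumes "cameron_walker E"
    and "cohen_macaulay_graph TYPE('k::field) E"
    and "leaf_triangle_structure E n m x y z w"
    and "V' = x ` {1..n} \<union> y ` {1..m} \<union> z ` {1..m}"
  shows "(\<forall>i. betti i (cover_ideal E :: ('v, 'k) mpol set) =
              (\<Sum>C\<in>min_vertex_covers E. card (V' - C) choose i))
       \<and> projective_dimension (cover_ideal E :: ('v, 'k) mpol set) =
              enat (Max {card (V' - C) | C. C \<in> min_vertex_covers E})
       \<and> (\<forall>i j. graded_betti i j (cover_ideal E :: ('v, 'k) mpol set) =
                graded_betti i j (cover_ideal E :: ('v, 'l::field) mpol set))"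
proof -
  obtain B where "leaf_triangle E B n m x y z w" using leaf_triangleI[OF assms(3)] .
  then interpret leaf_triangle E B n m x y z w .
  \<comment> \<open>The variable \<open>V'\<close> of the theorem is identified with the constant of
    the locale, to which the formulas refer.\<close>
  have V': "V' = leaf_triangle.V' n m x y z"
    unfolding assms(4) V'_def I_def K_def ..
  have "min_vertex_covers E \<noteq> {}"
    using assms(1) by (intro min_vertex_covers_nonempty) (simp add: cameron_walker_def)
  then show ?thesis
    unfolding cover_ideal_eq_min V'
    \<comment> \<open>Over both fields the graded Betti numbers reduce to the same expression in
      cardinalities.\<close>
    by (simp add: betti_formula projective_dimension_formula graded_betti_formula)
qed

end
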